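(* Let $\lambda=(\lambda_k)_{k\in\mathbb{Z}}$, $\beta=(\beta_k)_{k\in\mathbb{Z}}$ be sequences with nonzero components such that $\varphi_\lambda,\varphi_\beta\in L_2(\mathbb{T})$, and suppose that $\{|\beta_k|/|\lambda_k|:k\in\mathbb{Z}\}$ and $\{|\lambda_k|:k\in\mathbb{Z}\}$ are nondecreasing-type sequences. Then there exists a positive constant $c$ such that for all $m\in\mathbb{N}$ and $f\in\Phi_{\lambda,2}(\mathbb{T})$ $$\|f-Q_m(f)\|_2\le c\,\|f\|_{\Phi_{\lambda,2}(\mathbb{T})}\sqrt{\sum_{k\in\mathbb{Z},\,k\ne0}|\lambda_{mk}|^{-2}},$$ and consequently $$M_{2m+1}(U_{\lambda,2}(\mathbb{T}),\varphi_\beta)_2\le c\,\sqrt{\sum_{k\in\mathbb{Z},\,k\ne0}|\lambda_{mk}|^{-2}}.$$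
   Context: A sequence $\{\theta_k:k\in\mathbb{Z}\}$ is called a nondecreasing-type sequence if there is a constant $c>0$ such that $\theta_k\ge c\,\theta_l$ for all $k,l\in\mathbb{Z}$ with $|k|>|l|$. $\mathbb{N}=\{1,2,\dots\}$; $\mathbb{T}=[0,2\pi]$ with endpoints identified. Functions are real-valued (in particular $\varphi_\lambda$ and $\varphi_\beta$). $\|f\|_2=(2\pi)^{-1/2}(\int_{\mathbb{T}}|f|^2)^{1/2}$; $(f_1*f_2)(x)=(2\pi)^{-1}\int_{\mathbb{T}}f_1(y)f_2(x-y)dy$. For a sequence $\lambda$ with nonzero components, $\varphi_\lambda=\sum_{k\in\mathbb{Z}}\lambda_k^{-1}e^{ik\cdot}$ in the distributional sense; similarly $\varphi_\beta=\sum_{k\in\mathbb{Z}}\beta_k^{-1}e^{ik\cdot}$. $\Phi_{\lambda,2}(\mathbb{T})=\{f=\varphi_\lambda*g: g\in L_2(\mathbb{T})\}$ with $\|f\|_{\Phi_{\lambda,2}(\mathbb{T})}=\|g\|_2$, and $U_{\lambda,2}(\mathbb{T})$ is its unit ball. Put $H_m(x)=\sum_{|k|\le m}\frac{\beta_k}{\lambda_k} e^{ikx}$, $\delta_m=2\pi/(2m+1)$, $V_m(g)=H_m*g$, and for $f=\varphi_\lambda*g$ with $g\in L_2(\mathbb{T})$, $$Q_m(f)=\frac1{2m+1}\sum_{l=0}^{2m}V_m(g)(\delta_m l)\,\varphi_\beta(\cdot-\delta_m l).$$ For $\mathbb{W}\subset L_2(\mathbb{T})$ and $\psi\in L_2(\mathbb{T})$,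 $M_n(\mathbb{W},\psi)_2=\sup_{f\in\mathbb{W}}\inf_{c_l\in\mathbb{R},\,y_l\in\mathbb{T}}\|f-\sum_{l=1}^n c_l\psi(\cdot-y_l)\|_2$. The right-hand sides may be $+\infty$, in which case the bounds are trivial. *)

theory Defs
  imports "HOL-Analysis.Analysis"
begin

text \<open>
  Functions on the circle are $2\pi$-periodic functions on the real line, integrated over
  $[0,2\pi]$.  Elements of $L_2$ are represented by Borel functions (every class has such a
  representative); all notions below depend only on the a.e.-equivalence class.
\<close>

definition L2T :: "(real \<Rightarrow> real) set" where
  "L2T = {f. f \<in> borel_measurable borel \<and> (\<forall>x. f (x + 2 * pi) = f x) \<and>
             set_integrable lborel {0..2 * pi} (\<lambda>x. (f x)\<^sup>2)}"

definition L2norm :: "(real \<Rightarrow> real) \<Rightarrow> real" where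
  "L2norm f = (2 * pi) powr (- 1 / 2) * sqrt (LINT x:{0..2 * pi}|lborel. \<bar>f x\<bar>\<^sup>2)"

definition conv :: "(real \<Rightarrow> real) \<Rightarrow> (real \<Rightarrow> real) \<Rightarrow> real \<Rightarrow> real" where
  "conv f1 f2 x = 1 / (2 * pi) * (LINT y:{0..2 * pi}|lborel. f1 y * f2 (x - y))"

definition echar :: "int \<Rightarrow> real \<Rightarrow> complex" where
  "echar k x = exp (\<i> * of_int k * of_real x)"

definition nondecreasing_type :: "(int \<Rightarrow> real) \<Rightarrow> bool" where
  "nondecreasing_type \<theta> \<longleftrightarrow> (\<exists>c>0. \<forall>k l. \<bar>k\<bar> > \<bar>l\<bar> \<longrightarrow> \<theta> k \<ge> c * \<theta> l)"

text \<open>Test functions: infinitely differentiable, $2\pi$-periodic; \<open>D n\<close> is the $n$-th derivative.\<close>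

definition test_function :: "(real \<Rightarrow> complex) \<Rightarrow> bool" where
  "test_function h \<longleftrightarrow> (\<forall>x. h (x + 2 * pi) = h x) \<and>
     (\<exists>D. D 0 = h \<and> (\<forall>n x. (D n has_vector_derivative D (Suc n) x) (at x)))"

text \<open>\<open>\<phi>\<close> is the sum of the trigonometric series with coefficients \<open>a k\<close> in the sense of
  periodic distributions.\<close>

definition distributional_sum :: "(int \<Rightarrow> complex) \<Rightarrow> (real \<Rightarrow> real) \<Rightarrow> bool" where
  "distributional_sum a \<phi> \<longleftrightarrow> (\<forall>h. test_function h \<longrightarrow>
     ((\<lambda>k. LINT x:{0..2 * pi}|lborel. a k * echar k x * h x)
        has_sum (LINT x:{0..2 * pi}|lborel. complex_of_real (\<phi> x) * h x)) UNIV)"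

text \<open>\<open>\<phi>\<close> is (a representative of) the real-valued $L_2$-function
  $\varphi_\lambda = \sum_k \lambda_k^{-1} e^{ikx}$.\<close>

definition is_phi :: "(int \<Rightarrow> complex) \<Rightarrow> (real \<Rightarrow> real) \<Rightarrow> bool" where
  "is_phi lam \<phi> \<longleftrightarrow> \<phi> \<in> L2T \<and> distributional_sum (\<lambda>k. inverse (lam k)) \<phi>"

text \<open>In the definitions below, \<open>\<phi>\<close> is the function $\varphi_\lambda$ and \<open>\<psi>\<close> is $\varphi_\beta$.\<close>

definition is_density :: "(real \<Rightarrow> real) \<Rightarrow> (real \<Rightarrow> real) \<Rightarrow> (real \<Rightarrow> real) \<Rightarrow> bool" where
  "is_density \<phi> f g \<longleftrightarrow> g \<in> L2T \<and> (AE x in lborel. f x = conv \<phi> g x)"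

definition Phi_space :: "(real \<Rightarrow> real) \<Rightarrow> (real \<Rightarrow> real) set" where
  "Phi_space \<phi> = {f \<in> L2T. \<exists>g. is_density \<phi> f g}"

text \<open>All Fourier coefficients of $\varphi_\lambda$ are nonzero, so \<open>g\<close> is determined by \<open>f\<close> up to a
  null set, and the choice of the representative affects neither the norm nor \<open>Qop\<close> below.\<close>

definition density_of :: "(real \<Rightarrow> real) \<Rightarrow> (real \<Rightarrow> real) \<Rightarrow> real \<Rightarrow> real" where
  "density_of \<phi> f = (SOME g. is_density \<phi> f g)"

definition Phi_norm :: "(real \<Rightarrow> real) \<Rightarrow> (real \<Rightarrow> real) \<Rightarrow> real" where
  "Phi_norm \<phi> f = L2norm (density_of \<phi> f)"

definition Phi_ball :: "(real \<Rightarrow> real) \<Rightarrow> (real \<Rightarrow> real) set" where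
  "Phi_ball \<phi> = {f \<in> Phi_space \<phi>. Phi_norm \<phi> f \<le> 1}"

text \<open>The sum is real when $\varphi_\lambda$ and $\varphi_\beta$ are real-valued, and then \<open>Re\<close> only
  changes the type; see \<open>Hpoly_of_real\<close>.\<close>

definition Hpoly :: "(int \<Rightarrow> complex) \<Rightarrow> (int \<Rightarrow> complex) \<Rightarrow> nat \<Rightarrow> real \<Rightarrow> real" where
  "Hpoly lam bet m x = Re (\<Sum>k = - int m..int m. bet k / lam k * echar k x)"

definition Vop :: "(int \<Rightarrow> complex) \<Rightarrow> (int \<Rightarrow> complex) \<Rightarrow> nat \<Rightarrow> (real \<Rightarrow> real) \<Rightarrow> real \<Rightarrow> real" where
  "Vop lam bet m g = conv (Hpoly lam bet m) g"

definition mesh :: "nat \<Rightarrow> real" where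
  "mesh m = 2 * pi / (2 * real m + 1)"

definition Qop :: "(int \<Rightarrow> complex) \<Rightarrow> (int \<Rightarrow> complex) \<Rightarrow> (real \<Rightarrow> real) \<Rightarrow> (real \<Rightarrow> real) \<Rightarrow> nat
    \<Rightarrow> (real \<Rightarrow> real) \<Rightarrow> real \<Rightarrow> real" where
  "Qop lam bet \<phi> \<psi> m f x = 1 / (2 * real m + 1) *
     (\<Sum>l = 0..2 * m. Vop lam bet m (density_of \<phi> f) (mesh m * real l) * \<psi> (x - mesh m * real l))"

definition Mn :: "nat \<Rightarrow> (real \<Rightarrow> real) set \<Rightarrow> (real \<Rightarrow> real) \<Rightarrow> ennreal" where
  "Mn n W \<psi> = (SUP f\<in>W. INF (c, y)\<in>{(c :: nat \<Rightarrow> real, y :: nat \<Rightarrow> real). \<forall>l\<in>{1..n}. y l \<in> {0..2 * pi}}.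
     ennreal (L2norm (\<lambda>x. f x - (\<Sum>l = 1..n. c l * \<psi> (x - y l)))))"

lemma echar_continuous: "continuous_on A (echar k)"
  unfolding echar_def by (intro continuous_intros)

lemma echar_mult: "echar k x * echar l x = echar (k + l) x"
  by (simp add: echar_def exp_add [symmetric] algebra_simps)

lemma echar_cnj: "cnj (echar k x) = echar (- k) x"
  by (simp add: echar_def exp_cnj)

lemma norm_echar: "norm (echar k x) = 1"
  by (simp add: echar_def)

lemma echar_deriv: "(echar k has_vector_derivative \<i> * of_int k * echar k x) (at x within S)"
proof -
  have "((\<lambda>z. exp (\<i> * of_int k * z)) has_field_derivative
          \<i> * of_int k * exp (\<i> * of_int k * of_real x)) (at (of_real x))"
    by (auto intro!: derivative_eq_intros)
  then show ?thesis
    unfolding echar_def by (rule has_vector_derivative_real_field)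
qed

lemma echar_periodic: "echar k (x + 2 * pi) = echar k x"
proof -
  have "echar k (x + 2 * pi) = echar k x * exp (2 * of_int k * of_real pi * \<i>)"
    by (simp add: echar_def exp_add [symmetric] algebra_simps)
  also have "exp (2 * of_int k * of_real pi * \<i>) = 1"
    using exp_2pi_1_int [of k] by (simp add: mult_ac)
  finally show ?thesis
    by simp
qed

lemma echar_test_function: "test_function (echar k)"
proof -
  define D where "D n x = (\<i> * of_int k) ^ n * echar k x" for n :: nat and x
  have "D 0 = echar k"
    by (auto simp: D_def)
  moreover have "(D n has_vector_derivative D (Suc n) x) (at x)" for n x
  proof -
    have "((\<lambda>x. (\<i> * of_int k) ^ n * echar k x) has_vector_derivative
            (\<i> * of_int k) ^ n * (\<i> * of_int k * echar k x)) (at x)"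
      by (rule has_vector_derivative_mult_right [OF echar_deriv])
    then show ?thesis
      by (simp add: D_def [abs_def] algebra_simps)
  qed
  ultimately show ?thesis
    unfolding test_function_def using echar_periodic by blast
qed

lemma echar_integral:
  "(LINT x:{0..2 * pi}|lborel. echar k x) = (if k = 0 then 2 * pi else 0)"
proof (cases "k = 0")
  case True
  then show ?thesis
    by (simp add: echar_def set_lebesgue_integral_def scaleR_conv_of_real)
next
  case False
  have "(LINT x:{0..2 * pi}|lborel. echar k x)
      = echar k (2 * pi) / (\<i> * of_int k) - echar k 0 / (\<i> * of_int k)"
    unfolding set_lebesgue_integral_def
  proof (rule integral_FTC_atLeastAtMost)
    fix x
    have "((\<lambda>x. (1 / (\<i> * of_int k)) * echar k x) has_vector_derivative
            (1 / (\<i> * of_int k)) * (\<i> * of_int k * echar k x)) (at x within {0..2 * pi})"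
      by (rule has_vector_derivative_mult_right [OF echar_deriv])
    then show "((\<lambda>x. echar k x / (\<i> * of_int k)) has_vector_derivative echar k x)
        (at x within {0..2 * pi})"
      using False by simp
  qed (auto intro: echar_continuous)
  then show ?thesis
    using echar_periodic [of k 0] False by simp
qed

text \<open>The coefficients $\lambda_k^{-1}$ are the Fourier coefficients of $\varphi_\lambda$.\<close>

lemma is_phi_coeff:
  fixes lam :: "int \<Rightarrow> complex"
  assumes "is_phi lam \<phi>"
  shows "(LINT x:{0..2 * pi}|lborel. complex_of_real (\<phi> x) * echar (- j) x)
       = 2 * pi * inverse (lam j)"
proof -
  let ?c = "\<lambda>k. LINT x:{0..2 * pi}|lborel. inverse (lam k) * echar k x * echar (- j) x"
  have c: "?c k = (if k = j then 2 * pi * inverse (lam j) else 0)" for k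
    using echar_integral [of "k - j"] by (auto simp: mult.assoc echar_mult)
  have "(?c has_sum (LINT x:{0..2 * pi}|lborel. complex_of_real (\<phi> x) * echar (- j) x)) UNIV"
    using assms echar_test_function unfolding is_phi_def distributional_sum_def by blast
  moreover have "(?c has_sum (2 * pi * inverse (lam j))) UNIV"
    unfolding c by (rule has_sum_finite_neutralI [of "{j}"]) auto
  ultimately show ?thesis
    by (rule has_sum_unique)
qed

lemma is_phi_cnj:
  fixes lam :: "int \<Rightarrow> complex"
  assumes "is_phi lam \<phi>"
  shows "lam (- j) = cnj (lam j)"
proof -
  have "cnj (LINT x:{0..2 * pi}|lborel. complex_of_real (\<phi> x) * echar (- j) x)
      = (LINT x:{0..2 * pi}|lborel. complex_of_real (\<phi> x) * echar j x)"
    unfolding set_lebesgue_integral_def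
    by (subst Bochner_Integration.integral_cnj [symmetric], intro Bochner_Integration.integral_cong refl)
       (simp add: echar_cnj)
  then have "cnj (inverse (lam j)) = inverse (lam (- j))"
    using is_phi_coeff [OF assms, of j] is_phi_coeff [OF assms, of "- j"] by simp
  then show ?thesis
    by (metis complex_cnj_inverse inverse_inverse_eq)
qed

lemma Hpoly_of_real:
  fixes lam bet :: "int \<Rightarrow> complex"
  assumes "is_phi lam \<phi>" and "is_phi bet \<psi>"
  shows "complex_of_real (Hpoly lam bet m x) = (\<Sum>k = - int m..int m. bet k / lam k * echar k x)"
proof -
  let ?s = "\<Sum>k = - int m..int m. bet k / lam k * echar k x"
  have "cnj ?s = (\<Sum>k = - int m..int m. bet (- k) / lam (- k) * echar (- k) x)"
    by (simp add: echar_cnj is_phi_cnj [OF assms(1)] is_phi_cnj [OF assms(2)])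
  also have "\<dots> = ?s"
    by (rule sum.reindex_bij_witness [of _ uminus uminus]) auto
  finally show ?thesis
    unfolding Hpoly_def by (metis Reals_cnj_iff of_real_Re)
qed

text \<open>Bessel's inequality; it makes the sums over \<open>k\<close> in the error bound finite.\<close>

lemma is_phi_summable:
  fixes lam :: "int \<Rightarrow> complex"
  assumes "is_phi lam \<phi>"
  shows "(\<lambda>k. 1 / (cmod (lam k))\<^sup>2) summable_on UNIV"
proof (rule nonneg_bdd_above_summable_on)
  let ?I = "LINT x:{0..2 * pi}|lborel. (\<phi> x)\<^sup>2"
  have sq: "set_integrable lborel {0..2 * pi} (\<lambda>x. (\<phi> x)\<^sup>2)"
    and meas: "\<phi> \<in> borel_measurable borel"
    using assms by (auto simp: is_phi_def L2T_def)
  have "(\<Sum>k\<in>F. 1 / (cmod (lam k))\<^sup>2) \<le> ?I / (2 * pi)" if F: "finite F" for F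
  proof -
    define a where "a k = inverse (lam k)" for k
    define S where "S x = (\<Sum>k\<in>F. a k * echar k x)" for x
    have contS: "continuous_on A S" for A
      unfolding S_def by (intro continuous_intros echar_continuous)
    have bnd: "set_integrable lborel {0..2 * pi} (\<lambda>x. complex_of_real (\<phi> x) * echar k x)" for k
    proof (rule set_integrable_bound)
      show "set_integrable lborel {0..2 * pi} (\<lambda>x. 1 + (\<phi> x)\<^sup>2)"
        by (rule set_integral_add(1) [OF _ sq], rule borel_integrable_atLeastAtMost')
           (rule continuous_on_const)
      have "echar k \<in> borel_measurable borel"
        by (intro borel_measurable_continuous_onI echar_continuous)
      then show "set_borel_measurable lborel {0..2 * pi} (\<lambda>x. complex_of_real (\<phi> x) * echar k x)"
        using meas unfolding set_borel_measurable_def by measurable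
      have "\<bar>t\<bar> \<le> 1 + t\<^sup>2" for t :: real
        using zero_le_power2 [of "\<bar>t\<bar> - 1"] zero_le_power2 [of t]
        by (simp only: power2_diff power2_abs one_power2 mult_1_right)
      then show "AE x in lborel. x \<in> {0..2 * pi} \<longrightarrow>
          norm (complex_of_real (\<phi> x) * echar k x) \<le> norm (1 + (\<phi> x)\<^sup>2)"
        by (auto simp: norm_mult norm_echar)
    qed
    have SS: "set_integrable lborel {0..2 * pi} (\<lambda>x. S x * cnj (S x))"
      by (intro borel_integrable_atLeastAtMost' continuous_intros contS)
    have bnd': "set_integrable lborel {0..2 * pi} (\<lambda>x. cnj (a k) * (\<phi> x * echar (- k) x))" for k
      by (intro set_integrable_mult_right impI bnd)
    have cS: "complex_of_real (\<phi> x) * cnj (S x) = (\<Sum>k\<in>F. cnj (a k) * (\<phi> x * echar (- k) x))" for x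
      by (simp add: S_def echar_cnj sum_distrib_left algebra_simps)
    have pS: "set_integrable lborel {0..2 * pi} (\<lambda>x. complex_of_real (\<phi> x) * cnj (S x))"
      unfolding cS using bnd'
      by (simp add: set_integrable_def scaleR_sum_right del: of_real_mult)
    have IpS: "(LINT x:{0..2 * pi}|lborel. complex_of_real (\<phi> x) * cnj (S x))
        = (\<Sum>k\<in>F. 2 * pi * (a k * cnj (a k)))"
    proof -
      have "(LINT x:{0..2 * pi}|lborel. complex_of_real (\<phi> x) * cnj (S x))
         = (\<Sum>k\<in>F. LINT x:{0..2 * pi}|lborel. cnj (a k) * (\<phi> x * echar (- k) x))"
        unfolding cS using bnd' unfolding set_lebesgue_integral_def set_integrable_def
        by (simp add: scaleR_sum_right del: of_real_mult)
      also have "\<dots> = (\<Sum>k\<in>F. 2 * pi * (a k * cnj (a k)))"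
        by (simp only: set_integral_mult_right is_phi_coeff [OF assms] a_def)
           (simp add: mult_ac)
      finally show ?thesis .
    qed
    have ISS: "(LINT x:{0..2 * pi}|lborel. S x * cnj (S x)) = (\<Sum>k\<in>F. 2 * pi * (a k * cnj (a k)))"
    proof -
      have e: "S x * cnj (S x) = (\<Sum>k\<in>F. \<Sum>l\<in>F. a k * cnj (a l) * echar (k - l) x)" for x
      proof -
        have "S x * cnj (S x) = (\<Sum>k\<in>F. \<Sum>l\<in>F. (a k * echar k x) * (cnj (a l) * echar (- l) x))"
          by (simp add: S_def echar_cnj sum_product)
        moreover have "(a k * echar k x) * (cnj (a l) * echar (- l) x)
            = a k * cnj (a l) * echar (k - l) x" for k l
          using echar_mult [of k x "- l"] by (simp add: mult.assoc mult.left_commute)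
        ultimately show ?thesis
          by simp
      qed
      have i: "set_integrable lborel {0..2 * pi} (\<lambda>x. a k * cnj (a l) * echar (k - l) x)" for k l
        by (intro borel_integrable_atLeastAtMost' continuous_intros echar_continuous)
      have "(LINT x:{0..2 * pi}|lborel. S x * cnj (S x))
         = (\<Sum>k\<in>F. \<Sum>l\<in>F. LINT x:{0..2 * pi}|lborel. a k * cnj (a l) * echar (k - l) x)"
        unfolding e using i unfolding set_lebesgue_integral_def set_integrable_def
        by (simp add: scaleR_sum_right)
      also have "\<dots> = (\<Sum>k\<in>F. \<Sum>l\<in>F. if l = k then 2 * pi * (a k * cnj (a k)) else 0)"
        by (intro sum.cong refl) (auto simp: echar_integral)
      finally show ?thesis
        using F by simp
    qed
    let ?N = "\<Sum>k\<in>F. 1 / (cmod (lam k))\<^sup>2"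
    have N: "(\<Sum>k\<in>F. 2 * pi * (a k * cnj (a k))) = complex_of_real (2 * pi * ?N)"
    proof -
      have "a k * cnj (a k) = complex_of_real (1 / (cmod (lam k))\<^sup>2)" for k
        by (simp only: complex_norm_square [symmetric] a_def norm_inverse power_inverse)
           (simp add: inverse_eq_divide)
      then show ?thesis
        by (simp add: sum_distrib_left)
    qed
    have RepS: "set_integrable lborel {0..2 * pi} (\<lambda>x. Re (complex_of_real (\<phi> x) * cnj (S x)))"
      "(LINT x:{0..2 * pi}|lborel. Re (complex_of_real (\<phi> x) * cnj (S x))) = 2 * pi * ?N"
    proof -
      show "set_integrable lborel {0..2 * pi} (\<lambda>x. Re (complex_of_real (\<phi> x) * cnj (S x)))"
        using integrable_Re [OF pS [unfolded set_integrable_def]] by (simp add: set_integrable_def)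
      show "(LINT x:{0..2 * pi}|lborel. Re (complex_of_real (\<phi> x) * cnj (S x))) = 2 * pi * ?N"
        using integral_Re [OF pS [unfolded set_integrable_def]] IpS N
        by (simp add: set_lebesgue_integral_def)
    qed
    have ReSS: "set_integrable lborel {0..2 * pi} (\<lambda>x. Re (S x * cnj (S x)))"
      "(LINT x:{0..2 * pi}|lborel. Re (S x * cnj (S x))) = 2 * pi * ?N"
    proof -
      show "set_integrable lborel {0..2 * pi} (\<lambda>x. Re (S x * cnj (S x)))"
        using integrable_Re [OF SS [unfolded set_integrable_def]] by (simp add: set_integrable_def)
      show "(LINT x:{0..2 * pi}|lborel. Re (S x * cnj (S x))) = 2 * pi * ?N"
        using integral_Re [OF SS [unfolded set_integrable_def]] ISS N
        by (simp add: set_lebesgue_integral_def)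
    qed
    have "2 * pi * ?N + 2 * pi * ?N
        = (LINT x:{0..2 * pi}|lborel. Re (complex_of_real (\<phi> x) * cnj (S x))
             + Re (complex_of_real (\<phi> x) * cnj (S x)))"
      using set_integral_add(2) [OF RepS(1) RepS(1)] RepS(2) by simp
    also have "\<dots> \<le> (LINT x:{0..2 * pi}|lborel. (\<phi> x)\<^sup>2 + Re (S x * cnj (S x)))"
    proof (intro set_integral_mono set_integral_add RepS ReSS sq)
      fix x
      have "0 \<le> (\<phi> x - Re (S x))\<^sup>2 + (Im (S x))\<^sup>2"
        by simp
      then show "Re (complex_of_real (\<phi> x) * cnj (S x)) + Re (complex_of_real (\<phi> x) * cnj (S x))
          \<le> (\<phi> x)\<^sup>2 + Re (S x * cnj (S x))"
        by (simp add: power2_eq_square algebra_simps)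
    qed
    also have "\<dots> = ?I + 2 * pi * ?N"
      using set_integral_add(2) [OF sq ReSS(1)] ReSS(2) by simp
    finally show ?thesis
      by (simp add: field_simps)
  qed
  then show "bdd_above (sum (\<lambda>k. 1 / (cmod (lam k))\<^sup>2) ` {F. F \<subseteq> UNIV \<and> finite F})"
    by (intro bdd_aboveI2) auto
qed auto

lemma is_phi_summable_multiples:
  fixes lam :: "int \<Rightarrow> complex"
  assumes "is_phi lam \<phi>" and "m \<ge> 1"
  shows "(\<lambda>k. 1 / (cmod (lam (int m * k)))\<^sup>2) summable_on (UNIV - {0})"
proof -
  have inj: "inj_on (\<lambda>k. int m * k) (UNIV - {0})"
    using assms(2) by (auto simp: inj_on_def)
  have "(\<lambda>k. 1 / (cmod (lam k))\<^sup>2) summable_on ((\<lambda>k. int m * k) ` (UNIV - {0}))"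
    by (rule summable_on_subset_banach [OF is_phi_summable [OF assms(1)]]) auto
  then show ?thesis
    by (simp add: summable_on_reindex [OF inj] o_def)
qed

end

theory Submission
  imports Defs
begin

text \<open>
  Let $g$ be the density of $f$ and let $j'$ be the residue of $j$ modulo $2m+1$ in $[-m,m]$.
  Orthogonality of characters on the grid shows that $Q_m(f)$ has the $j$-th Fourier coefficient
  $\beta_{j'}\hat g(j')/(\lambda_{j'}\beta_j)$ (aliasing), so the coefficients of $f-Q_m(f)$ vanish
  for $|j|\le m$.  For $|j|>m$ write $j=j'+(2m+1)s$ with $s\ne0$; then $|j|>m|s|$ and $|j|>|j'|$, and
  the two monotonicity hypotheses bound the coefficient by a constant times
  $|\hat g(j)|/|\lambda_m|+|\hat g(j')|/|\lambda_{ms}|$.  Since $j\mapsto(j',s)$ is injective, summing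
  squares gives the estimate by Parseval's identity.  The completeness of the trigonometric system
  comes from the Stone--Weierstrass theorem on the unit circle.
\<close>

section \<open>Square-integrable functions on the circle and Bessel's inequality\<close>

text \<open>The operator works because two multipliers cancel: convolution with \<open>H_m\<close>
  multiplies the coefficient of index k by \<open>bet k / lam k\<close>, and averaging shifts of the
  function with coefficients \<open>1 / bet k\<close> divides by \<open>bet k\<close> again. The
  grid has exactly as many points as there are frequencies in the window, so a high frequency is
  contaminated by a single low one. The contamination carries the factor
  \<open>bet r / lam r / bet j\<close>, in which only the ratio of \<open>bet\<close> to
  \<open>lam\<close> is controlled. Monotonicity of that ratio trades the factor for
  \<open>1 / lam j\<close>, and this is why the final bound no longer mentions \<open>bet\<close>.
  The term with \<open>1 / lam m\<close> costs nothing extra, since it is the summand k = 1 of the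
  sum in the bound. Only finite sets of frequencies are ever summed on the left. Two one-sided forms
  of Parseval suffice: Bessel's inequality for the density, and, for the error, the converse bound
  on the norm by finite partial sums, which is where density of trigonometric polynomials
  enters.\<close>

definition circ :: "real measure" where
  "circ = restrict_space lborel {0..2 * pi}"

lemma circ_set_integral:
  fixes f :: "real \<Rightarrow> 'a :: {banach, second_countable_topology}"
  shows "(LINT x:{0..2 * pi}|lborel. f x) = (LINT x|circ. f x)"
  unfolding circ_def set_lebesgue_integral_def by (subst integral_restrict_space) auto

lemma circ_set_integrable:
  fixes f :: "real \<Rightarrow> 'a :: {banach, second_countable_topology}"
  shows "set_integrable lborel {0..2 * pi} f \<longleftrightarrow> integrable circ f"
  unfolding circ_def set_integrable_def by (subst integrable_restrict_space) auto

lemma measurable_circ: "f \<in> borel \<rightarrow>\<^sub>M N \<Longrightarrow> f \<in> circ \<rightarrow>\<^sub>M N"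
  unfolding circ_def by (simp add: measurable_restrict_space1 measurable_lborel1)

lemma space_circ [simp]: "space circ = {0..2 * pi}"
  by (simp add: circ_def space_restrict_space)

lemma finite_measure_circ: "finite_measure circ"
  unfolding circ_def
  by (rule finite_measureI) (simp add: emeasure_restrict_space space_restrict_space)

interpretation circ: finite_measure circ
  by (rule finite_measure_circ)

interpretation circ_pair: pair_sigma_finite circ circ ..

lemma AE_circ: "(AE x in lborel. P x) \<Longrightarrow> AE x in circ. P x"
  unfolding circ_def by (subst AE_restrict_space_iff) auto

lemma ident_measurable_circ [measurable]: "(\<lambda>x. x) \<in> circ \<rightarrow>\<^sub>M borel"
  by (rule measurable_circ) simp

lemma echar_measurable [measurable]: "echar k \<in> borel_measurable borel"
  by (intro borel_measurable_continuous_onI echar_continuous)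

text \<open>Complex values and the absence of a periodicity condition let real functions, characters
  and their differences be treated alike; \<open>L2T\<close> enters only through the cast to complex
  numbers.\<close>

definition sq_integrable :: "(real \<Rightarrow> complex) \<Rightarrow> bool" where
  "sq_integrable f \<longleftrightarrow> f \<in> borel_measurable circ \<and> integrable circ (\<lambda>x. (cmod (f x))\<^sup>2)"

text \<open>The pointwise bound of a product of norms by the sum of their squares is enough here; no
  Cauchy-Schwarz inequality is involved.\<close>

lemma sq_integrable_integrable_mult:
  assumes "sq_integrable f" "sq_integrable g"
  shows "integrable circ (\<lambda>x. f x * g x)"
proof (rule Bochner_Integration.integrable_bound)
  show "integrable circ (\<lambda>x. (cmod (f x))\<^sup>2 + (cmod (g x))\<^sup>2)"
    using assms by (simp add: sq_integrable_def)
  show "(\<lambda>x. f x * g x) \<in> borel_measurable circ"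
    using assms unfolding sq_integrable_def by (elim conjE) measurable
  have "a * b \<le> a\<^sup>2 + b\<^sup>2" if "a \<ge> 0" "b \<ge> 0" for a b :: real
    using sum_squares_bound [of a b] mult_nonneg_nonneg [OF that] by linarith
  then show "AE x in circ. norm (f x * g x) \<le> norm ((cmod (f x))\<^sup>2 + (cmod (g x))\<^sup>2)"
    by (auto simp: norm_mult)
qed

lemma sq_integrable_bounded:
  assumes "f \<in> borel_measurable circ" and "\<And>x. x \<in> {0..2 * pi} \<Longrightarrow> cmod (f x) \<le> B"
  shows "sq_integrable f"
  unfolding sq_integrable_def
proof (intro conjI circ.integrable_const_bound [of _ "B\<^sup>2"])
  show "AE x in circ. norm ((cmod (f x))\<^sup>2) \<le> B\<^sup>2"
    using assms(2) by (intro AE_I2) (auto intro: power_mono)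
qed (use assms in auto)

lemma sq_integrable_echar: "sq_integrable (echar k)"
  by (rule sq_integrable_bounded [of _ 1]) (auto simp: norm_echar intro: measurable_circ)

lemma sq_integrable_cmult: "sq_integrable f \<Longrightarrow> sq_integrable (\<lambda>x. c * f x)"
  unfolding sq_integrable_def by (auto simp: norm_mult power_mult_distrib)

lemma sq_integrable_cnj: "sq_integrable f \<Longrightarrow> sq_integrable (\<lambda>x. cnj (f x))"
  unfolding sq_integrable_def by (auto intro: measurable_compose [OF _ borel_measurable_continuous_onI])

lemma cmod_add_squared_le: "(cmod (a + b))\<^sup>2 \<le> 2 * (cmod a)\<^sup>2 + 2 * (cmod b)\<^sup>2"
proof -
  have "(cmod (a + b))\<^sup>2 \<le> (cmod a + cmod b)\<^sup>2"
    by (simp add: norm_triangle_ineq power_mono)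
  also have "\<dots> \<le> 2 * (cmod a)\<^sup>2 + 2 * (cmod b)\<^sup>2"
    using sum_squares_bound [of "cmod a" "cmod b"] by (simp add: power2_sum)
  finally show ?thesis .
qed

lemma sq_integrable_add:
  assumes "sq_integrable f" "sq_integrable g" shows "sq_integrable (\<lambda>x. f x + g x)"
  unfolding sq_integrable_def
proof
  show "integrable circ (\<lambda>x. (cmod (f x + g x))\<^sup>2)"
  proof (rule Bochner_Integration.integrable_bound)
    show "integrable circ (\<lambda>x. 2 * (cmod (f x))\<^sup>2 + 2 * (cmod (g x))\<^sup>2)"
      using assms by (simp add: sq_integrable_def)
  qed (use assms in \<open>auto simp: sq_integrable_def intro: cmod_add_squared_le\<close>)
qed (use assms in \<open>simp add: sq_integrable_def borel_measurable_add\<close>)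

lemma sq_integrable_zero: "sq_integrable (\<lambda>x. 0)"
  by (rule sq_integrable_bounded [of _ 0]) auto

lemma sq_integrable_sum: "(\<And>k. k \<in> F \<Longrightarrow> sq_integrable (f k)) \<Longrightarrow> sq_integrable (\<lambda>x. \<Sum>k\<in>F. f k x)"
  by (induction F rule: infinite_finite_induct) (auto intro: sq_integrable_add sq_integrable_zero)

lemma sq_integrable_diff: "sq_integrable f \<Longrightarrow> sq_integrable g \<Longrightarrow> sq_integrable (\<lambda>x. f x - g x)"
  using sq_integrable_add [of f "\<lambda>x. (-1) * g x"] sq_integrable_cmult [of g "-1"] by simp

lemma sq_integrable_L2T: "f \<in> L2T \<Longrightarrow> sq_integrable (\<lambda>x. complex_of_real (f x))"
  by (auto simp: L2T_def sq_integrable_def circ_set_integrable [symmetric])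

lemma L2norm_squared: "(L2norm f)\<^sup>2 = (LINT x|circ. (cmod (complex_of_real (f x)))\<^sup>2) / (2 * pi)"
proof -
  have "((2 * pi) powr (- 1 / 2))\<^sup>2 = 1 / (2 * pi)"
    by (simp add: power2_eq_square powr_add [symmetric] powr_minus_divide)
  then show ?thesis
    unfolding L2norm_def circ_set_integral
    by (simp add: power_mult_distrib)
qed

section \<open>Fourier coefficients and the Bessel identity\<close>

definition fcoef :: "(real \<Rightarrow> complex) \<Rightarrow> int \<Rightarrow> complex" where
  "fcoef f k = (LINT x|circ. f x * echar (- k) x) / (2 * pi)"

lemma fcoef_add: "sq_integrable f \<Longrightarrow> sq_integrable g \<Longrightarrow> fcoef (\<lambda>x. f x + g x) k = fcoef f k + fcoef g k"
  unfolding fcoef_def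
  by (simp add: distrib_right sq_integrable_integrable_mult sq_integrable_echar add_divide_distrib)

lemma fcoef_diff: "sq_integrable f \<Longrightarrow> sq_integrable g \<Longrightarrow> fcoef (\<lambda>x. f x - g x) k = fcoef f k - fcoef g k"
  unfolding fcoef_def
  by (simp add: left_diff_distrib sq_integrable_integrable_mult sq_integrable_echar diff_divide_distrib)

lemma fcoef_cmult: "fcoef (\<lambda>x. c * f x) k = c * fcoef f k"
  unfolding fcoef_def by (simp add: mult.assoc)

lemma fcoef_sum:
  "(\<And>i. i \<in> I \<Longrightarrow> sq_integrable (f i)) \<Longrightarrow> fcoef (\<lambda>x. \<Sum>i\<in>I. f i x) k = (\<Sum>i\<in>I. fcoef (f i) k)"
  by (induction I rule: infinite_finite_induct)
     (auto simp: fcoef_add sq_integrable_sum, auto simp: fcoef_def)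

lemma integral_echar_circ: "(LINT x|circ. echar k x) = (if k = 0 then 2 * pi else 0)"
  using echar_integral [of k] by (simp add: circ_set_integral)

lemma fcoef_echar: "fcoef (echar k) j = (if k = j then 1 else 0)"
  unfolding fcoef_def echar_mult integral_echar_circ by auto

lemma fcoef_is_phi: "is_phi lam \<phi> \<Longrightarrow> fcoef (\<lambda>x. complex_of_real (\<phi> x)) k = inverse (lam k)"
  using is_phi_coeff [of lam \<phi> k] by (simp add: fcoef_def circ_set_integral)

text \<open>Serves the Bessel identity twice: with \<open>h\<close> itself it gives the mixed term,
  and with the polynomial in place of \<open>h\<close> it gives the norm of the polynomial.\<close>

lemma integral_mult_cnj_trig:
  assumes h: "sq_integrable h"
  shows "(LINT x|circ. h x * cnj (\<Sum>k\<in>F. d k * echar k x)) = 2 * pi * (\<Sum>k\<in>F. cnj (d k) * fcoef h k)"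
proof -
  have "(LINT x|circ. h x * cnj (\<Sum>k\<in>F. d k * echar k x))
      = (LINT x|circ. (\<Sum>k\<in>F. cnj (d k) * (h x * echar (- k) x)))"
    by (simp add: echar_cnj sum_distrib_left algebra_simps)
  also have "\<dots> = (\<Sum>k\<in>F. cnj (d k) * (LINT x|circ. h x * echar (- k) x))"
    by (subst Bochner_Integration.integral_sum)
       (auto intro!: integrable_mult_right sq_integrable_integrable_mult h sq_integrable_echar)
  finally show ?thesis
    by (simp add: fcoef_def sum_distrib_left)
qed

text \<open>The coefficients \<open>d\<close> are left arbitrary so that both directions of Parseval
  follow. Taking \<open>d = fcoef h\<close> gives Bessel's inequality; for any other
  \<open>d\<close>, the last sum being nonnegative, a good approximation of \<open>h\<close> bounds
  the norm of \<open>h\<close> by its coefficients.\<close>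

lemma Bessel_identity:
  assumes h: "sq_integrable h" and F: "finite F"
  shows "(LINT x|circ. (cmod (h x - (\<Sum>k\<in>F. d k * echar k x)))\<^sup>2)
    = (LINT x|circ. (cmod (h x))\<^sup>2) - 2 * pi * (\<Sum>k\<in>F. (cmod (fcoef h k))\<^sup>2)
      + 2 * pi * (\<Sum>k\<in>F. (cmod (d k - fcoef h k))\<^sup>2)"
proof -
  define S where "S x = (\<Sum>k\<in>F. d k * echar k x)" for x
  have S: "sq_integrable S"
    unfolding S_def [abs_def] by (intro sq_integrable_sum sq_integrable_cmult sq_integrable_echar)
  have fS: "fcoef S j = d j" if "j \<in> F" for j
  proof -
    have "fcoef S j = (\<Sum>k\<in>F. d k * (if k = j then 1 else 0))"
      unfolding S_def [abs_def] by (simp add: fcoef_sum sq_integrable_cmult sq_integrable_echar fcoef_cmult fcoef_echar)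
    then show ?thesis
      using that F by (simp add: sum.delta if_distrib cong: if_cong)
  qed
  have hS: "(LINT x|circ. h x * cnj (S x)) = 2 * pi * (\<Sum>k\<in>F. cnj (d k) * fcoef h k)"
    unfolding S_def by (rule integral_mult_cnj_trig [OF h])
  have SS: "(LINT x|circ. S x * cnj (S x)) = 2 * pi * (\<Sum>k\<in>F. cnj (d k) * d k)"
    using integral_mult_cnj_trig [OF S, where F = F and d = d] fS by (simp add: S_def)
  have Sh: "(LINT x|circ. S x * cnj (h x)) = cnj (LINT x|circ. h x * cnj (S x))"
    by (subst Bochner_Integration.integral_cnj [symmetric]) (simp add: mult.commute)
  have i: "integrable circ (\<lambda>x. h x * cnj (h x))" "integrable circ (\<lambda>x. h x * cnj (S x))"
    "integrable circ (\<lambda>x. S x * cnj (h x))" "integrable circ (\<lambda>x. S x * cnj (S x))"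
    by (intro sq_integrable_integrable_mult sq_integrable_cnj h S)+
  have "complex_of_real (LINT x|circ. (cmod (h x - S x))\<^sup>2) = (LINT x|circ. (h x - S x) * cnj (h x - S x))"
    by (subst integral_complex_of_real [symmetric]) (simp only: complex_norm_square)
  also have "\<dots> = (LINT x|circ. h x * cnj (h x) - h x * cnj (S x) - S x * cnj (h x) + S x * cnj (S x))"
    by (intro Bochner_Integration.integral_cong) (auto simp: algebra_simps)
  also have "\<dots> = (LINT x|circ. h x * cnj (h x)) - (LINT x|circ. h x * cnj (S x))
      - (LINT x|circ. S x * cnj (h x)) + (LINT x|circ. S x * cnj (S x))"
    using i by simp
  also have "\<dots> = (LINT x|circ. h x * cnj (h x)) - 2 * pi * (\<Sum>k\<in>F. cnj (d k) * fcoef h k)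
      - 2 * pi * (\<Sum>k\<in>F. d k * cnj (fcoef h k)) + 2 * pi * (\<Sum>k\<in>F. cnj (d k) * d k)"
    unfolding Sh hS SS by simp
  \<comment> \<open>Completing the square for each frequency turns the mixed terms and the norm of
    the polynomial into the squared distance from \<open>d k\<close> to
    \<open>fcoef h k\<close>.\<close>
  also have "\<dots> = (LINT x|circ. h x * cnj (h x)) - 2 * pi * (\<Sum>k\<in>F. fcoef h k * cnj (fcoef h k))
      + 2 * pi * (\<Sum>k\<in>F. (d k - fcoef h k) * cnj (d k - fcoef h k))"
    by (simp add: algebra_simps sum.distrib sum_subtractf)
  also have "(LINT x|circ. h x * cnj (h x)) = complex_of_real (LINT x|circ. (cmod (h x))\<^sup>2)"
    by (subst integral_complex_of_real [symmetric]) (simp only: complex_norm_square)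
  finally have "complex_of_real (LINT x|circ. (cmod (h x - S x))\<^sup>2) = complex_of_real
     ((LINT x|circ. (cmod (h x))\<^sup>2) - 2 * pi * (\<Sum>k\<in>F. (cmod (fcoef h k))\<^sup>2)
      + 2 * pi * (\<Sum>k\<in>F. (cmod (d k - fcoef h k))\<^sup>2))"
    by (simp only: complex_norm_square [symmetric]) (simp del: of_real_power add: of_real_power [symmetric])
  then show ?thesis
    unfolding S_def by (simp only: of_real_eq_iff)
qed

lemma Bessel_inequality:
  assumes "sq_integrable h" "finite F"
  shows "2 * pi * (\<Sum>k\<in>F. (cmod (fcoef h k))\<^sup>2) \<le> (LINT x|circ. (cmod (h x))\<^sup>2)"
proof -
  have "0 \<le> (LINT x|circ. (cmod (h x - (\<Sum>k\<in>F. fcoef h k * echar k x)))\<^sup>2)"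
    by simp
  then show ?thesis
    unfolding Bessel_identity [OF assms] by simp
qed

section \<open>Density of trigonometric polynomials\<close>

definition trig_poly :: "(real \<Rightarrow> complex) \<Rightarrow> bool" where
  "trig_poly p \<longleftrightarrow> (\<exists>F d. finite F \<and> p = (\<lambda>x. \<Sum>k\<in>F. d k * echar k x))"

lemma trig_poly_echar: "trig_poly (\<lambda>x. c * echar k x)"
  unfolding trig_poly_def by (intro exI [of _ "{k}"] exI [of _ "\<lambda>_. c"]) simp

lemma trig_poly_const: "trig_poly (\<lambda>x. c)"
  using trig_poly_echar [of c 0] by (simp add: echar_def)

lemma trig_poly_add:
  assumes "trig_poly p" "trig_poly q"
  shows "trig_poly (\<lambda>x. p x + q x)"
proof -
  obtain F d G e where F: "finite F" "p = (\<lambda>x. \<Sum>k\<in>F. d k * echar k x)"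
    and G: "finite G" "q = (\<lambda>x. \<Sum>k\<in>G. e k * echar k x)"
    using assms unfolding trig_poly_def by metis
  have "p x = (\<Sum>k\<in>F \<union> G. (if k \<in> F then d k else 0) * echar k x)" for x
    unfolding F by (rule sum.mono_neutral_cong_left) (use F G in auto)
  moreover have "q x = (\<Sum>k\<in>F \<union> G. (if k \<in> G then e k else 0) * echar k x)" for x
    unfolding G by (rule sum.mono_neutral_cong_left) (use F G in auto)
  ultimately have "p x + q x = (\<Sum>k\<in>F \<union> G. ((if k \<in> F then d k else 0) + (if k \<in> G then e k else 0)) * echar k x)" for x
    by (simp add: sum.distrib distrib_right)
  then show ?thesis
    unfolding trig_poly_def using F(1) G(1)
    by (intro exI [of _ "F \<union> G"] exI [of _ "\<lambda>k. (if k \<in> F then d k else 0) + (if k \<in> G then e k else 0)"]) auto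
qed

lemma trig_poly_sum: "(\<And>i. i \<in> I \<Longrightarrow> trig_poly (p i)) \<Longrightarrow> trig_poly (\<lambda>x. \<Sum>i\<in>I. p i x)"
  by (induction I rule: infinite_finite_induct) (auto intro: trig_poly_add trig_poly_const)

lemma trig_poly_mult:
  assumes "trig_poly p" "trig_poly q"
  shows "trig_poly (\<lambda>x. p x * q x)"
proof -
  obtain F d G e where F: "p = (\<lambda>x. \<Sum>k\<in>F. d k * echar k x)"
    and G: "q = (\<lambda>x. \<Sum>k\<in>G. e k * echar k x)"
    using assms unfolding trig_poly_def by metis
  have "trig_poly (\<lambda>x. d k * echar k x * (e l * echar l x))" for k l
  proof -
    have "d k * echar k x * (e l * echar l x) = (d k * e l) * echar (k + l) x" for x
      by (simp add: echar_mult [symmetric])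
    then show ?thesis
      by (simp only: trig_poly_echar)
  qed
  then show ?thesis
    unfolding F G sum_product by (intro trig_poly_sum)
qed

text \<open>Stone-Weierstrass yields real polynomials on the plane. They are generated by constants
  and real-linear functionals, and such a functional at \<open>cis x\<close> is a combination of
  \<open>cos x\<close> and \<open>sin x\<close>, which Euler's formulas express by characters of
  index 1 and -1.\<close>

lemma trig_poly_real_polynomial_cis:
  assumes "real_polynomial_function P"
  shows "trig_poly (\<lambda>x. complex_of_real (P (cis x)))"
  using assms
proof induction
  case (linear f)
  interpret f: bounded_linear f by fact
  have "f (cis x) = cos x * f 1 + sin x * f \<i>" for x
  proof -
    have "cis x = cos x *\<^sub>R 1 + sin x *\<^sub>R \<i>"
      by (simp add: complex_eq_iff)
    then show ?thesis
      by (simp only: f.add f.scaleR) simp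
  qed
  moreover have "complex_of_real (cos x) = 1 / 2 * echar 1 x + 1 / 2 * echar (-1) x"
    "complex_of_real (sin x) = - \<i> / 2 * echar 1 x + \<i> / 2 * echar (-1) x" for x
    by (simp_all add: echar_def complex_eq_iff cis_conv_exp [symmetric] Re_exp Im_exp)
  ultimately show ?case
    by (simp only: of_real_add of_real_mult)
       (intro trig_poly_add trig_poly_mult trig_poly_echar trig_poly_const)
next
  case (const c)
  show ?case
    by (rule trig_poly_const)
qed (auto intro: trig_poly_add trig_poly_mult)

lemma uniform_trig_approx:
  fixes v :: "real \<Rightarrow> real"
  assumes v: "continuous_on {0..2 * pi} v" "v 0 = v (2 * pi)" and e: "e > 0"
  obtains p where "trig_poly p" "\<And>x. x \<in> {0..2 * pi} \<Longrightarrow> cmod (complex_of_real (v x) - p x) < e"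
proof -
  define w where "w z = v (Arg2pi z)" for z
  \<comment> \<open>At the right endpoint \<open>cis x\<close> is 1 and \<open>Arg2pi\<close>
    returns 0; the equality of the two end values of \<open>v\<close> is used exactly there.\<close>
  have wv: "w (cis x) = v x" if "x \<in> {0..2 * pi}" for x
  proof (cases "x = 2 * pi")
    case True
    then show ?thesis
      using v(2) Arg2pi_of_real [of 1] by (simp add: w_def)
  next
    case False
    then have "Arg2pi (cis x) = x"
      using that Arg2pi_unique [of 1 x "cis x"] by (auto simp: cis_conv_exp)
    then show ?thesis
      by (simp add: w_def)
  qed
  have im: "cis ` {0..2 * pi} = sphere 0 1"
  proof (intro equalityI subsetI)
    fix z :: complex assume "z \<in> sphere 0 1"
    then have "z = cis (Arg2pi z)" "Arg2pi z \<in> {0..2 * pi}"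
      using Arg2pi_eq [of z] Arg2pi_ge_0 [of z] Arg2pi_lt_2pi [of z] by (auto simp: cis_conv_exp)
    then show "z \<in> cis ` {0..2 * pi}"
      by blast
  qed auto
  have cis: "continuous_on {0..2 * pi} cis"
    by (intro continuous_intros)
  have "continuous_on (sphere 0 1) w"
  proof -
    \<comment> \<open>\<open>Arg2pi\<close> jumps at 1, so \<open>w\<close> is not visibly
      continuous there. A continuous map from a compact space onto a Hausdorff space is a quotient
      map, so continuity of \<open>w\<close> may be tested after composition with
      \<open>cis\<close>, which is \<open>v\<close>.\<close>
    have "quotient_map (top_of_set {0..2 * pi}) (top_of_set (sphere 0 1)) cis"
      by (intro T1_Spaces.continuous_imp_quotient_map)
         (use im cis in \<open>auto simp: compact_space_subtopology Hausdorff_space_subtopology\<close>)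
    moreover have "continuous_map (top_of_set {0..2 * pi}) euclidean (w \<circ> cis)"
      using continuous_on_eq [OF v(1), of "w \<circ> cis"] wv by simp
    ultimately have "continuous_map (top_of_set (sphere 0 1)) euclidean w"
      by (rule continuous_compose_quotient_map)
    then show ?thesis
      by simp
  qed
  then obtain P where P: "real_polynomial_function P" "\<And>z. z \<in> sphere 0 1 \<Longrightarrow> \<bar>w z - P z\<bar> < e"
    using Stone_Weierstrass_real_polynomial_function [OF compact_sphere _ e] by metis
  show thesis
  proof
    show "trig_poly (\<lambda>x. complex_of_real (P (cis x)))"
      by (rule trig_poly_real_polynomial_cis [OF P(1)])
    show "cmod (complex_of_real (v x) - complex_of_real (P (cis x))) < e" if "x \<in> {0..2 * pi}" for x
      using P(2) [of "cis x"] wv [OF that] by (simp flip: of_real_diff)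
  qed
qed

section \<open>Approximation in mean square\<close>

lemma sq_integrable_trig_poly:
  assumes "trig_poly p" shows "sq_integrable p"
proof -
  obtain F d where p: "p = (\<lambda>x. \<Sum>k\<in>F. d k * echar k x)"
    using assms unfolding trig_poly_def by blast
  have "sq_integrable (\<lambda>x. d k * echar k x)" for k
    by (rule sq_integrable_cmult [OF sq_integrable_echar])
  then show ?thesis
    unfolding p by (rule sq_integrable_sum)
qed

text \<open>The approximation is already contained in \<open>measurable_on\<close>, whose definition
  asks for continuous functions converging off a negligible set. What remains is to carry that null
  set from Lebesgue measure over to \<open>circ\<close>.\<close>

lemma AE_circ_continuous_approx:
  fixes h :: "real \<Rightarrow> real"
  assumes h: "h \<in> borel_measurable borel"
  obtains g where "\<And>n::nat. continuous_on UNIV (g n)" "AE x in circ. (\<lambda>n. g n x) \<longlonglongrightarrow> h x"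
proof -
  have "h measurable_on UNIV"
    using h by (intro lebesgue_measurable_imp_measurable_on) (auto intro: measurable_completion)
  then obtain N g where N: "negligible N" and g: "\<And>n::nat. continuous_on UNIV (g n)"
    and lim: "\<And>x. x \<notin> N \<Longrightarrow> (\<lambda>n. g n x) \<longlonglongrightarrow> h x"
    unfolding measurable_on_def by auto
  have "AE x in lebesgue. x \<notin> N"
    using N by (simp add: AE_not_in negligible_iff_null_sets)
  then have "AE x in circ. x \<notin> N"
    by (intro AE_circ) (simp add: AE_completion_iff)
  then have "AE x in circ. (\<lambda>n. g n x) \<longlonglongrightarrow> h x"
    by eventually_elim (rule lim)
  with g show thesis
    by (rule that)
qed

text \<open>The cutoff factor makes the approximants vanish at both endpoints, hence periodic.\<close>

lemma AE_circ_periodic_approx: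
  fixes h :: "real \<Rightarrow> real"
  assumes h: "h \<in> borel_measurable borel" and B: "B \<ge> 0" "\<And>x. \<bar>h x\<bar> \<le> B"
  obtains v where "\<And>n::nat. continuous_on UNIV (v n)" "\<And>n. v n 0 = v n (2 * pi)"
    "\<And>n x. \<bar>v n x\<bar> \<le> B" "AE x in circ. (\<lambda>n. v n x) \<longlonglongrightarrow> h x"
proof -
  obtain g where g: "\<And>n::nat. continuous_on UNIV (g n)" "AE x in circ. (\<lambda>n. g n x) \<longlonglongrightarrow> h x"
    using AE_circ_continuous_approx [OF h] by blast
  define cut where "cut n x = max 0 (min 1 (real n * (x * (2 * pi - x))))" for n x
  \<comment> \<open>Clamping to the range of \<open>h\<close> provides the uniform bound for
    dominated convergence and does not disturb the limit, because \<open>h\<close> itself stays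
    within \<open>B\<close>.\<close>
  define v where "v n x = max (- B) (min B (g n x)) * cut n x" for n x
  have cut_lim: "(\<lambda>n. cut n x) \<longlonglongrightarrow> 1" if x: "x \<in> {0<..<2 * pi}" for x
  proof (rule tendsto_eventually)
    have pos: "x * (2 * pi - x) > 0"
      using x by simp
    obtain k :: nat where "1 / (x * (2 * pi - x)) \<le> real k"
      using real_arch_simple by blast
    then have "cut n x = 1" if "n \<ge> k" for n
    proof -
      have "1 / (x * (2 * pi - x)) \<le> real n"
        using \<open>1 / (x * (2 * pi - x)) \<le> real k\<close> that by linarith
      then have "1 \<le> real n * (x * (2 * pi - x))"
        using pos by (simp only: pos_divide_le_eq)
      then show ?thesis
        by (simp add: cut_def)
    qed
    then show "\<forall>\<^sub>F n in sequentially. cut n x = 1"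
      by (auto simp: eventually_sequentially)
  qed
  show thesis
  proof
    show "continuous_on UNIV (v n)" for n
      unfolding v_def cut_def by (intro continuous_intros g)
    show "v n 0 = v n (2 * pi)" for n
      by (simp add: v_def cut_def)
    show "\<bar>v n x\<bar> \<le> B" for n x
    proof -
      have "\<bar>max (- B) (min B (g n x))\<bar> \<le> B" "0 \<le> cut n x" "cut n x \<le> 1"
        using B(1) by (auto simp: cut_def)
      then show ?thesis
        unfolding v_def abs_mult using mult_mono [of "\<bar>max (- B) (min B (g n x))\<bar>" B "\<bar>cut n x\<bar>" 1] B(1) by simp
    qed
    have "AE x in circ. x \<noteq> 0" "AE x in circ. x \<noteq> 2 * pi"
      by (intro AE_circ AE_lborel_singleton)+
    moreover have "AE x in circ. x \<in> {0..2 * pi}"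
      by (rule AE_I2) simp
    ultimately show "AE x in circ. (\<lambda>n. v n x) \<longlonglongrightarrow> h x"
      using g(2)
    proof eventually_elim
      case (elim x)
      then have "(\<lambda>n. v n x) \<longlonglongrightarrow> max (- B) (min B (h x)) * 1"
        unfolding v_def by (intro tendsto_intros cut_lim) auto
      moreover have "max (- B) (min B (h x)) = h x"
        using B(2) [of x] by (simp add: abs_le_iff)
      ultimately show ?case
        by simp
    qed
  qed
qed

lemma integral_add_squared_le:
  assumes "sq_integrable f" "sq_integrable g"
  shows "(LINT x|circ. (cmod (f x + g x))\<^sup>2) \<le> 2 * (LINT x|circ. (cmod (f x))\<^sup>2) + 2 * (LINT x|circ. (cmod (g x))\<^sup>2)"
proof -
  have "(LINT x|circ. (cmod (f x + g x))\<^sup>2) \<le> (LINT x|circ. 2 * (cmod (f x))\<^sup>2 + 2 * (cmod (g x))\<^sup>2)"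
    using assms sq_integrable_add [OF assms]
    by (intro integral_mono) (auto simp: sq_integrable_def cmod_add_squared_le)
  then show ?thesis
    using assms by (simp add: sq_integrable_def)
qed

text \<open>Almost-everywhere convergence of continuous periodic functions becomes mean-square
  convergence by domination with a constant; one of these functions is then approximated
  uniformly.\<close>

lemma trig_dense_bounded:
  fixes h :: "real \<Rightarrow> real"
  assumes h: "h \<in> borel_measurable borel" and B: "B \<ge> 0" "\<And>x. \<bar>h x\<bar> \<le> B" and e: "e > 0"
  obtains p where "trig_poly p" "(LINT x|circ. (cmod (complex_of_real (h x) - p x))\<^sup>2) < e"
proof -
  obtain v where v: "\<And>n::nat. continuous_on UNIV (v n)" "\<And>n. v n 0 = v n (2 * pi)"
    "\<And>n x. \<bar>v n x\<bar> \<le> B" "AE x in circ. (\<lambda>n. v n x) \<longlonglongrightarrow> h x"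
    using AE_circ_periodic_approx [OF h B] by blast
  have vm: "v n \<in> borel_measurable borel" for n
    using v(1) by (rule borel_measurable_continuous_onI)
  have hm: "h \<in> borel_measurable circ" "v n \<in> borel_measurable circ" for n
    using h vm by (auto intro: measurable_circ)
  have "(\<lambda>n. LINT x|circ. (h x - v n x)\<^sup>2) \<longlonglongrightarrow> (LINT x|circ. 0)"
  proof (rule integral_dominated_convergence)
    show "integrable circ (\<lambda>x. (2 * B)\<^sup>2)"
      by simp
    show "AE x in circ. (\<lambda>n. (h x - v n x)\<^sup>2) \<longlonglongrightarrow> 0"
      using v(4)
    proof eventually_elim
      case (elim x)
      then have "(\<lambda>n. (h x - v n x)\<^sup>2) \<longlonglongrightarrow> (h x - h x)\<^sup>2"
        by (intro tendsto_intros)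
      then show ?case
        by simp
    qed
    show "AE x in circ. norm ((h x - v n x)\<^sup>2) \<le> (2 * B)\<^sup>2" for n
    proof (rule AE_I2)
      fix x
      have "\<bar>h x - v n x\<bar> \<le> 2 * B"
        using B(2) [of x] v(3) [of n x] by linarith
      then have "\<bar>h x - v n x\<bar>\<^sup>2 \<le> (2 * B)\<^sup>2"
        by (intro power_mono) auto
      then show "norm ((h x - v n x)\<^sup>2) \<le> (2 * B)\<^sup>2"
        by simp
    qed
  qed (use hm in auto)
  then have "\<forall>\<^sub>F n in sequentially. (LINT x|circ. (h x - v n x)\<^sup>2) < e / 4"
    using e by (intro order_tendstoD(2)) auto
  then obtain n where n: "(LINT x|circ. (h x - v n x)\<^sup>2) < e / 4"
    using eventually_happens' [OF sequentially_bot] by blast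
  \<comment> \<open>A uniform error \<open>r\<close> on an interval of length \<open>2 * pi\<close>
    costs \<open>e / 8\<close> in mean square, and twice \<open>e / 4\<close> plus twice
    \<open>e / 8\<close> is still below \<open>e\<close>.\<close>
  define r where "r = sqrt (e / (16 * pi))"
  have r: "r > 0" "r\<^sup>2 = e / (16 * pi)"
    using e by (auto simp: r_def)
  obtain p where p: "trig_poly p" "\<And>x. x \<in> {0..2 * pi} \<Longrightarrow> cmod (complex_of_real (v n x) - p x) < r"
    using uniform_trig_approx [OF continuous_on_subset [OF v(1) [of n] subset_UNIV] v(2) [of n] r(1)] by blast
  have sqh: "sq_integrable (\<lambda>x. complex_of_real (h x))"
    using hm B by (intro sq_integrable_bounded [of _ B]) auto
  have sqv: "sq_integrable (\<lambda>x. complex_of_real (v n x))"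
    using hm v(3) by (intro sq_integrable_bounded [of _ B]) auto
  have d1: "sq_integrable (\<lambda>x. complex_of_real (h x) - complex_of_real (v n x))"
    and d2: "sq_integrable (\<lambda>x. complex_of_real (v n x) - p x)"
    by (intro sq_integrable_diff sqh sqv sq_integrable_trig_poly p(1))+
  have "(LINT x|circ. (cmod (complex_of_real (v n x) - p x))\<^sup>2) \<le> (LINT x|circ. r\<^sup>2)"
  proof (rule integral_mono)
    fix x assume "x \<in> space circ"
    then show "(cmod (complex_of_real (v n x) - p x))\<^sup>2 \<le> r\<^sup>2"
      using p(2) [of x] by (intro power_mono) auto
  qed (use d2 in \<open>auto simp: sq_integrable_def\<close>)
  also have "\<dots> = e / 8"
    using measure_restrict_space [of "{0..2 * pi}" lborel "{0..2 * pi}"]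
    by (simp add: r circ_def space_restrict_space)
  finally have 2: "(LINT x|circ. (cmod (complex_of_real (v n x) - p x))\<^sup>2) \<le> e / 8" .
  have "(LINT x|circ. (cmod (complex_of_real (h x) - p x))\<^sup>2)
      = (LINT x|circ. (cmod ((complex_of_real (h x) - complex_of_real (v n x)) + (complex_of_real (v n x) - p x)))\<^sup>2)"
    by simp
  also have "\<dots> \<le> 2 * (LINT x|circ. (cmod (complex_of_real (h x) - complex_of_real (v n x)))\<^sup>2)
      + 2 * (LINT x|circ. (cmod (complex_of_real (v n x) - p x))\<^sup>2)"
    by (rule integral_add_squared_le [OF d1 d2])
  also have "(LINT x|circ. (cmod (complex_of_real (h x) - complex_of_real (v n x)))\<^sup>2) = (LINT x|circ. (h x - v n x)\<^sup>2)"
    by (simp flip: of_real_diff)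
  finally have "(LINT x|circ. (cmod (complex_of_real (h x) - p x))\<^sup>2) < e"
    using n 2 e by linarith
  with p(1) show thesis
    by (rule that)
qed

text \<open>Truncation at height n reduces to bounded functions: the truncation error vanishes
  pointwise from some n on, and its square is dominated by the integrable function
  \<open>(h x)\<^sup>2\<close>.\<close>

lemma trig_dense:
  fixes h :: "real \<Rightarrow> real"
  assumes h: "h \<in> borel_measurable borel" and sq: "integrable circ (\<lambda>x. (h x)\<^sup>2)" and e: "e > 0"
  obtains p where "trig_poly p" "(LINT x|circ. (cmod (complex_of_real (h x) - p x))\<^sup>2) < e"
proof -
  define u where "u n x = max (- real n) (min (real n) (h x))" for n :: nat and x
  have um: "u n \<in> borel_measurable borel" for n
    unfolding u_def using h by measurable
  have hm: "h \<in> borel_measurable circ" "u n \<in> borel_measurable circ" for n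
    using h um by (auto intro: measurable_circ)
  have "(\<lambda>n. LINT x|circ. (h x - u n x)\<^sup>2) \<longlonglongrightarrow> (LINT x|circ. 0)"
  proof (rule integral_dominated_convergence)
    show "AE x in circ. (\<lambda>n. (h x - u n x)\<^sup>2) \<longlonglongrightarrow> 0"
    proof (intro AE_I2 tendsto_eventually)
      fix x
      obtain k :: nat where k: "\<bar>h x\<bar> \<le> real k"
        using real_arch_simple by blast
      have "(h x - u n x)\<^sup>2 = 0" if "n \<ge> k" for n
      proof -
        have "real k \<le> real n"
          using that by simp
        with k show ?thesis
          by (simp add: u_def)
      qed
      then show "\<forall>\<^sub>F n in sequentially. (h x - u n x)\<^sup>2 = 0"
        by (auto simp: eventually_sequentially)
    qed
    show "AE x in circ. norm ((h x - u n x)\<^sup>2) \<le> (h x)\<^sup>2" for n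
    proof (rule AE_I2)
      fix x
      have "\<bar>h x - u n x\<bar> \<le> \<bar>h x\<bar>"
        by (simp add: u_def)
      then have "(h x - u n x)\<^sup>2 \<le> (h x)\<^sup>2"
        by (simp only: abs_le_square_iff)
      then show "norm ((h x - u n x)\<^sup>2) \<le> (h x)\<^sup>2"
        by simp
    qed
  qed (use hm sq in auto)
  then have "\<forall>\<^sub>F n in sequentially. (LINT x|circ. (h x - u n x)\<^sup>2) < e / 4"
    using e by (intro order_tendstoD(2)) auto
  then obtain n where n: "(LINT x|circ. (h x - u n x)\<^sup>2) < e / 4"
    using eventually_happens' [OF sequentially_bot] by blast
  have ub: "\<bar>u n x\<bar> \<le> real n" for x
    by (simp add: u_def)
  obtain p where p: "trig_poly p" "(LINT x|circ. (cmod (complex_of_real (u n x) - p x))\<^sup>2) < e / 4"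
    by (rule trig_dense_bounded [OF um _ ub, of "e / 4"]) (use e in auto)
  have sqh: "sq_integrable (\<lambda>x. complex_of_real (h x))"
    using hm sq by (simp add: sq_integrable_def)
  have squ: "sq_integrable (\<lambda>x. complex_of_real (u n x))"
    using hm ub by (intro sq_integrable_bounded [of _ "real n"]) auto
  have d1: "sq_integrable (\<lambda>x. complex_of_real (h x) - complex_of_real (u n x))"
    and d2: "sq_integrable (\<lambda>x. complex_of_real (u n x) - p x)"
    by (intro sq_integrable_diff sqh squ sq_integrable_trig_poly p(1))+
  have "(LINT x|circ. (cmod (complex_of_real (h x) - p x))\<^sup>2)
      = (LINT x|circ. (cmod ((complex_of_real (h x) - complex_of_real (u n x)) + (complex_of_real (u n x) - p x)))\<^sup>2)"
    by simp
  also have "\<dots> \<le> 2 * (LINT x|circ. (cmod (complex_of_real (h x) - complex_of_real (u n x)))\<^sup>2)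
      + 2 * (LINT x|circ. (cmod (complex_of_real (u n x) - p x))\<^sup>2)"
    by (rule integral_add_squared_le [OF d1 d2])
  also have "(LINT x|circ. (cmod (complex_of_real (h x) - complex_of_real (u n x)))\<^sup>2) = (LINT x|circ. (h x - u n x)\<^sup>2)"
    by (simp flip: of_real_diff)
  finally have "(LINT x|circ. (cmod (complex_of_real (h x) - p x))\<^sup>2) < e"
    using n p(2) e by linarith
  with p(1) show thesis
    by (rule that)
qed

text \<open>Let \<open>p\<close> be a trigonometric polynomial within \<open>e\<close> of
  \<open>h\<close> and \<open>F\<close> its set of frequencies. The Bessel identity bounds the norm
  of \<open>h\<close> by \<open>e\<close> and the partial sum over \<open>F\<close>; since
  \<open>C\<close> does not depend on \<open>F\<close>, letting \<open>e\<close> tend to 0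
  finishes.\<close>

lemma L2norm_le_fcoef:
  fixes h :: "real \<Rightarrow> real"
  assumes h: "h \<in> borel_measurable borel" and sq: "integrable circ (\<lambda>x. (h x)\<^sup>2)"
    and bound: "\<And>F. finite F \<Longrightarrow> (\<Sum>k\<in>F. (cmod (fcoef (\<lambda>x. complex_of_real (h x)) k))\<^sup>2) \<le> C"
  shows "(L2norm h)\<^sup>2 \<le> C"
proof -
  let ?h = "\<lambda>x. complex_of_real (h x)"
  have sq_integrable: "sq_integrable ?h"
    using measurable_circ [OF h] sq by (simp add: sq_integrable_def)
  have "(LINT x|circ. (cmod (?h x))\<^sup>2) \<le> 2 * pi * C + e" if e: "e > 0" for e
  proof -
    obtain p where p: "trig_poly p" "(LINT x|circ. (cmod (?h x - p x))\<^sup>2) < e"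
      using trig_dense [OF h sq e] .
    then obtain F d where F: "finite F" "p = (\<lambda>x. \<Sum>k\<in>F. d k * echar k x)"
      unfolding trig_poly_def by metis
    have "(LINT x|circ. (cmod (?h x))\<^sup>2)
        \<le> (LINT x|circ. (cmod (?h x - p x))\<^sup>2) + 2 * pi * (\<Sum>k\<in>F. (cmod (fcoef ?h k))\<^sup>2)"
      unfolding F(2) Bessel_identity [OF sq_integrable F(1)] by (simp add: sum_nonneg)
    also have "\<dots> \<le> e + 2 * pi * C"
      using p(2) bound [OF F(1)] by (intro add_mono mult_left_mono) auto
    finally show ?thesis
      by simp
  qed
  then have "(LINT x|circ. (cmod (?h x))\<^sup>2) \<le> 2 * pi * C"
    by (rule field_le_epsilon)
  then show ?thesis
    unfolding L2norm_squared by (simp add: field_simps)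
qed

section \<open>Translations and convolutions\<close>

lemma periodic_int:
  fixes u :: "real \<Rightarrow> 'a"
  assumes "\<And>x. u (x + 2 * pi) = u x"
  shows "u (x + of_int k * (2 * pi)) = u x"
proof -
  interpret periodic_fun_simple u "2 * pi"
    by standard (rule assms)
  show ?thesis
    by (rule plus_of_int)
qed

lemma integrable_indicator_shift:
  fixes u :: "real \<Rightarrow> complex"
  shows "set_integrable lborel {a + t..<b + t} u \<longleftrightarrow> set_integrable lborel {a..<b} (\<lambda>x. u (x + t))"
    and "(LINT x:{a + t..<b + t}|lborel. u x) = (LINT x:{a..<b}|lborel. u (x + t))"
proof -
  have *: "(\<lambda>x. indicator {a + t..<b + t} (t + 1 * x) *\<^sub>R u (t + 1 * x)) = (\<lambda>x. indicator {a..<b} x *\<^sub>R u (x + t))"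
    by (auto simp: fun_eq_iff indicator_def add.commute)
  show "set_integrable lborel {a + t..<b + t} u \<longleftrightarrow> set_integrable lborel {a..<b} (\<lambda>x. u (x + t))"
    using lborel_integrable_real_affine_iff [of 1 "\<lambda>x. indicator {a + t..<b + t} x *\<^sub>R u x" t] 
    unfolding set_integrable_def * by simp
  show "(LINT x:{a + t..<b + t}|lborel. u x) = (LINT x:{a..<b}|lborel. u (x + t))"
    using lborel_integral_real_affine [of 1 "\<lambda>x. indicator {a + t..<b + t} x *\<^sub>R u x" t] 
    unfolding set_lebesgue_integral_def * by simp
qed

text \<open>Half-open intervals can be cut and rejoined without overlap, which the shift argument
  needs; the dropped endpoint is a null set.\<close>

lemma circ_half_open:
  fixes u :: "real \<Rightarrow> complex"
  shows "integrable circ u \<longleftrightarrow> set_integrable lborel {0..<2 * pi} u"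
    and "(LINT x|circ. u x) = (LINT x:{0..<2 * pi}|lborel. u x)"
  unfolding circ_set_integrable [symmetric] circ_set_integral [symmetric]
    set_integrable_def set_lebesgue_integral_def
  by (rule integrable_discrete_difference [of "{2 * pi}"] integral_discrete_difference [of "{2 * pi}"],
      auto simp: indicator_def)+

text \<open>After removal of whole periods the shifted window is cut at \<open>2 * pi\<close>, and
  the part beyond that point is moved back by one period, where it fills the gap on the
  left.\<close>

lemma circ_shift:
  fixes u :: "real \<Rightarrow> complex"
  assumes per: "\<And>x. u (x + 2 * pi) = u x" and int: "integrable circ u"
  shows "integrable circ (\<lambda>x. u (x + t))" and "(LINT x|circ. u (x + t)) = (LINT x|circ. u x)"
proof -
  define k where "k = \<lfloor>t / (2 * pi)\<rfloor>"
  define s where "s = t - of_int k * (2 * pi)"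
  have s: "0 \<le> s" "s < 2 * pi"
  proof -
    have "of_int k \<le> t / (2 * pi)" "t / (2 * pi) < of_int k + 1"
      unfolding k_def by linarith+
    then show "0 \<le> s" "s < 2 * pi"
      by (simp_all add: s_def field_simps)
  qed
  have us: "u (x + t) = u (x + s)" for x
    using periodic_int [of u "x + s" k, OF per] by (simp add: s_def algebra_simps)
  have i0: "set_integrable lborel {0..<2 * pi} u"
    using int by (simp add: circ_half_open)
  have i1: "set_integrable lborel {2 * pi..<4 * pi} u"
    using integrable_indicator_shift(1) [of 0 "2 * pi" "2 * pi" u] i0 by (simp add: per)
  have A: "set_integrable lborel {s..<2 * pi} u" "set_integrable lborel {0..<s} u"
    using s by (auto intro!: set_integrable_subset [OF i0])
  have B: "set_integrable lborel {2 * pi..<2 * pi + s} u"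
    using s by (auto intro!: set_integrable_subset [OF i1])
  have un: "{0 + s..<2 * pi + s} = {s..<2 * pi} \<union> {2 * pi..<2 * pi + s}" "{0..<2 * pi} = {0..<s} \<union> {s..<2 * pi}"
    using s by auto
  show "integrable circ (\<lambda>x. u (x + t))"
    unfolding us circ_half_open integrable_indicator_shift(1) [symmetric] un(1)
    by (intro set_integrable_Un A B) auto
  have "(LINT x|circ. u (x + t)) = (LINT x:{s..<2 * pi}|lborel. u x) + (LINT x:{2 * pi..<2 * pi + s}|lborel. u x)"
    unfolding us circ_half_open integrable_indicator_shift(2) [symmetric] un(1)
    by (rule set_integral_Un) (use A B in auto)
  also have "(LINT x:{2 * pi..<2 * pi + s}|lborel. u x) = (LINT x:{0..<s}|lborel. u x)"
    using integrable_indicator_shift(2) [of 0 "2 * pi" s u] by (simp add: per add.commute)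
  also have "(LINT x:{s..<2 * pi}|lborel. u x) + (LINT x:{0..<s}|lborel. u x) = (LINT x|circ. u x)"
    unfolding circ_half_open un(2) by (subst set_integral_Un) (use A in auto)
  finally show "(LINT x|circ. u (x + t)) = (LINT x|circ. u x)" .
qed

lemma circ_reflect:
  fixes u :: "real \<Rightarrow> complex"
  assumes per: "\<And>x. u (x + 2 * pi) = u x" and int: "integrable circ u"
  shows "integrable circ (\<lambda>y. u (x - y))" and "(LINT y|circ. u (x - y)) = (LINT y|circ. u y)"
proof -
  \<comment> \<open>The reflection of y to \<open>2 * pi - y\<close> maps the basic interval onto
    itself, so reflection at an arbitrary \<open>x\<close> is obtained by composing it with a
    translation.\<close>
  define w where "w y = u (y + (x - 2 * pi))" for y
  have "w (2 * pi - y) = u (x - y)" for y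
    by (simp add: w_def)
  then have *: "(\<lambda>y. indicator {0..2 * pi} (2 * pi + - 1 * y) *\<^sub>R w (2 * pi + - 1 * y))
      = (\<lambda>y. indicator {0..2 * pi} y *\<^sub>R u (x - y))"
    by (auto simp: fun_eq_iff indicator_def)
  have w: "integrable circ w" "(LINT y|circ. w y) = (LINT y|circ. u y)"
    unfolding w_def by (rule circ_shift [OF per int])+
  show "integrable circ (\<lambda>y. u (x - y))"
    using w(1) lborel_integrable_real_affine_iff [of "- 1" "\<lambda>y. indicator {0..2 * pi} y *\<^sub>R w y" "2 * pi"]
    unfolding * circ_set_integrable [symmetric] set_integrable_def by simp
  show "(LINT y|circ. u (x - y)) = (LINT y|circ. u y)"
    using w(2) lborel_integral_real_affine [of "- 1" "\<lambda>y. indicator {0..2 * pi} y *\<^sub>R w y" "2 * pi"]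
    unfolding * circ_set_integral [symmetric] set_lebesgue_integral_def by simp
qed

section \<open>Fourier coefficients of translates and convolutions\<close>

lemma L2T_iff:
  "f \<in> L2T \<longleftrightarrow> f \<in> borel_measurable borel \<and> (\<forall>x. f (x + 2 * pi) = f x) \<and> sq_integrable (\<lambda>x. complex_of_real (f x))"
  using measurable_circ [of f borel] by (auto simp: L2T_def sq_integrable_def circ_set_integrable)

lemma L2T_add: "f \<in> L2T \<Longrightarrow> g \<in> L2T \<Longrightarrow> (\<lambda>x. f x + g x) \<in> L2T"
  by (auto simp: L2T_iff sq_integrable_add)

lemma L2T_cmult: "f \<in> L2T \<Longrightarrow> (\<lambda>x. c * f x) \<in> L2T"
  by (auto simp: L2T_iff sq_integrable_cmult)

lemma L2T_diff: "f \<in> L2T \<Longrightarrow> g \<in> L2T \<Longrightarrow> (\<lambda>x. f x - g x) \<in> L2T"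
  by (auto simp: L2T_iff sq_integrable_diff)

lemma L2T_sum: "(\<And>i. i \<in> I \<Longrightarrow> f i \<in> L2T) \<Longrightarrow> (\<lambda>x. \<Sum>i\<in>I. f i x) \<in> L2T"
  by (induction I rule: infinite_finite_induct) (auto simp: L2T_add, auto simp: L2T_iff sq_integrable_zero)

lemma L2T_shift:
  assumes f: "f \<in> L2T"
  shows "(\<lambda>x. f (x - t)) \<in> L2T"
proof -
  have [measurable]: "f \<in> borel_measurable borel" and per: "f (x + 2 * pi) = f x" for x
    using f by (auto simp: L2T_iff)
  have "integrable circ (\<lambda>x. complex_of_real ((f x)\<^sup>2))"
    using f by (simp add: L2T_def circ_set_integrable complex_of_real_integrable_eq del: of_real_power)
  then have "integrable circ (\<lambda>x. complex_of_real ((f (x + - t))\<^sup>2))"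
    by (rule circ_shift(1) [rotated]) (simp add: per)
  moreover have "f (x + 2 * pi - t) = f (x - t)" for x
    using per [of "x - t"] by (simp add: algebra_simps)
  ultimately show ?thesis
    by (auto simp: L2T_def circ_set_integrable complex_of_real_integrable_eq simp del: of_real_power)
qed

lemma fcoef_shift:
  assumes f: "f \<in> L2T"
  shows "fcoef (\<lambda>x. complex_of_real (f (x - t))) k = echar (- k) t * fcoef (\<lambda>x. complex_of_real (f x)) k"
proof -
  let ?u = "\<lambda>x. complex_of_real (f x) * echar (- k) x"
  have e: "echar (- k) x = echar (- k) t * echar (- k) (x + - t)" for x
    by (simp add: echar_def exp_add [symmetric] algebra_simps)
  have "(LINT x|circ. complex_of_real (f (x - t)) * echar (- k) x)
      = (LINT x|circ. echar (- k) t * ?u (x + - t))"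
    by (subst e) (simp add: mult_ac)
  also have "\<dots> = echar (- k) t * (LINT x|circ. ?u (x + - t))"
    by simp
  also have "(LINT x|circ. ?u (x + - t)) = (LINT x|circ. ?u x)"
    using f by (intro circ_shift) (auto simp: L2T_iff echar_periodic intro!: sq_integrable_integrable_mult sq_integrable_echar)
  finally show ?thesis
    by (simp add: fcoef_def)
qed

lemma of_real_conv:
  "complex_of_real (conv f1 f2 x) = (LINT y|circ. complex_of_real (f1 y) * complex_of_real (f2 (x - y))) / (2 * pi)"
  unfolding conv_def circ_set_integral
  by (simp flip: of_real_mult add: integral_complex_of_real)

lemma fcoef_conv:
  assumes f: "f \<in> L2T" and g: "g \<in> L2T"
  shows "fcoef (\<lambda>x. complex_of_real (conv f g x)) k
    = fcoef (\<lambda>x. complex_of_real (f x)) k * fcoef (\<lambda>x. complex_of_real (g x)) k"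
proof -
  have [measurable]: "f \<in> borel_measurable borel" "g \<in> borel_measurable borel"
    and gper: "g (x + 2 * pi) = g x" for x
    using f g by (auto simp: L2T_iff)
  have sf: "sq_integrable (\<lambda>x. complex_of_real (f x))" and sg: "sq_integrable (\<lambda>x. complex_of_real (g x))"
    using f g by (auto simp: L2T_iff)
  let ?K = "\<lambda>y x. complex_of_real (f y) * complex_of_real (g (x - y)) * echar (- k) x"
  have int_g: "integrable circ (\<lambda>x. complex_of_real \<bar>g x\<bar>)"
    using sq_integrable_integrable_mult [OF sg sq_integrable_echar [of 0], THEN integrable_norm]
    by (simp add: norm_mult norm_echar complex_of_real_integrable_eq)
  have int_f: "integrable circ (\<lambda>x. \<bar>f x\<bar>)"
    using sq_integrable_integrable_mult [OF sf sq_integrable_echar [of 0], THEN integrable_norm]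
    by (simp add: norm_mult norm_echar)
  \<comment> \<open>By translation invariance the inner integral is the same constant multiple of
    \<open>\<bar>f y\<bar>\<close> for every \<open>y\<close>; this gives the joint integrability
    for Fubini. The cast is there because \<open>circ_shift\<close> speaks of complex
    functions.\<close>
  have inner_norm: "(LINT x|circ. norm (?K y x)) = \<bar>f y\<bar> * (LINT x|circ. \<bar>g x\<bar>)" for y
  proof -
    have "complex_of_real (LINT x|circ. \<bar>g (x + - y)\<bar>) = complex_of_real (LINT x|circ. \<bar>g x\<bar>)"
      unfolding integral_complex_of_real [symmetric]
      by (rule circ_shift [OF _ int_g]) (simp add: gper)
    then show ?thesis
      by (simp add: norm_mult norm_echar)
  qed
  have inner: "integrable circ (?K y)" "(LINT x|circ. ?K y x)
      = 2 * pi * fcoef (\<lambda>x. complex_of_real (g x)) k * (complex_of_real (f y) * echar (- k) y)" for y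
  proof -
    have "integrable circ (\<lambda>x. complex_of_real (g (x - y)) * echar (- k) x)"
      using L2T_shift [OF g] by (intro sq_integrable_integrable_mult sq_integrable_echar) (simp add: L2T_iff)
    then show "integrable circ (?K y)"
      by (simp add: mult.assoc)
    show "(LINT x|circ. ?K y x)
      = 2 * pi * fcoef (\<lambda>x. complex_of_real (g x)) k * (complex_of_real (f y) * echar (- k) y)"
      using fcoef_shift [OF g, of y k] by (simp add: mult.assoc fcoef_def)
  qed
  have prod: "integrable (circ \<Otimes>\<^sub>M circ) (case_prod ?K)"
  proof (rule circ_pair.Fubini_integrable)
    show "case_prod ?K \<in> borel_measurable (circ \<Otimes>\<^sub>M circ)"
      by measurable
    show "integrable circ (\<lambda>y. LINT x|circ. norm (case (y, x) of (y, x) \<Rightarrow> ?K y x))"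
      unfolding prod.case inner_norm using int_f by simp
    show "AE y in circ. integrable circ (\<lambda>x. case (y, x) of (y, x) \<Rightarrow> ?K y x)"
      using inner by simp
  qed
  have "fcoef (\<lambda>x. complex_of_real (conv f g x)) k
      = (LINT x|circ. LINT y|circ. ?K y x) / (2 * pi) / (2 * pi)"
    unfolding fcoef_def of_real_conv by simp
  also have "(LINT x|circ. LINT y|circ. ?K y x) = (LINT y|circ. LINT x|circ. ?K y x)"
    by (rule circ_pair.Fubini_integral [OF prod])
  also have "\<dots> = 2 * pi * fcoef (\<lambda>x. complex_of_real (g x)) k * (LINT y|circ. complex_of_real (f y) * echar (- k) y)"
    unfolding inner by simp
  finally show ?thesis
    by (simp add: fcoef_def)
qed

text \<open>The formula holds at every point, not merely almost everywhere, as it must: the operator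
  samples this function at individual grid points.\<close>

lemma Vop_of_real:
  assumes "is_phi lam \<phi>" "is_phi bet \<psi>" and g: "g \<in> L2T"
  shows "complex_of_real (Vop lam bet m g x)
    = (\<Sum>k = - int m..int m. bet k / lam k * fcoef (\<lambda>x. complex_of_real (g x)) k * echar k x)"
proof -
  let ?u = "\<lambda>k y. complex_of_real (g y) * echar (- k) y"
  have e: "echar k y = echar k x * echar (- k) (x - y)" for k y
    by (simp add: echar_def exp_add [symmetric] algebra_simps)
  have u: "integrable circ (\<lambda>y. ?u k (x - y))" "(LINT y|circ. ?u k (x - y)) = (LINT y|circ. ?u k y)" for k
    using g by (intro circ_reflect; auto simp: L2T_iff echar_periodic intro!: sq_integrable_integrable_mult sq_integrable_echar)+
  have "(LINT y|circ. complex_of_real (Hpoly lam bet m y) * complex_of_real (g (x - y)))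
      = (LINT y|circ. (\<Sum>k = - int m..int m. bet k / lam k * echar k x * ?u k (x - y)))"
    unfolding Hpoly_of_real [OF assms(1,2)] sum_distrib_right
    by (subst e) (simp add: mult_ac)
  also have "\<dots> = (\<Sum>k = - int m..int m. bet k / lam k * echar k x * (LINT y|circ. ?u k (x - y)))"
    by (subst Bochner_Integration.integral_sum) (auto intro!: integrable_mult_right u)
  finally show ?thesis
    unfolding Vop_def of_real_conv u fcoef_def by (simp add: sum_divide_distrib mult_ac)
qed

section \<open>Sampling on the grid and aliasing\<close>

text \<open>The samples are the powers of a root of unity \<open>q\<close> with
  \<open>q ^ (2 * m + 1) = 1\<close>. Their geometric sum vanishes unless \<open>q = 1\<close>,
  which is the divisibility condition.\<close>

lemma sum_echar_mesh:
  "(\<Sum>l = 0..2 * m. echar k (mesh m * real l)) = (if (2 * int m + 1) dvd k then 2 * of_nat m + 1 else 0)"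
proof -
  define q where "q = echar k (mesh m)"
  have pow: "echar k (mesh m * real l) = q ^ l" for l
    by (simp add: q_def echar_def exp_of_nat_mult [symmetric] mult_ac)
  have "2 * real m + 1 > 0"
    by linarith
  then have mesh: "mesh m * (2 * real m + 1) = 2 * pi" and "mesh m \<noteq> 0"
    by (auto simp: mesh_def)
  have "mesh m * real (2 * m + 1) = 2 * pi"
    using mesh by (simp add: add.commute)
  then have "q ^ (2 * m + 1) = echar k (2 * pi)"
    by (simp only: pow [symmetric])
  then have q1: "q ^ Suc (2 * m) = 1"
    using echar_periodic [of k 0] by (simp add: echar_def)
  have "q = 1 \<longleftrightarrow> (\<exists>n::int. of_int k * mesh m = of_int (2 * n) * pi)"
    by (simp add: q_def echar_def exp_eq_1)
  also have "\<dots> \<longleftrightarrow> (\<exists>n::int. real_of_int k = real_of_int ((2 * int m + 1) * n))"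
  proof -
    have "of_int k * mesh m = of_int (2 * n) * pi \<longleftrightarrow> real_of_int k = real_of_int ((2 * int m + 1) * n)" for n
    proof -
      have "real_of_int (2 * n) * pi = real_of_int n * (2 * pi)"
        by simp
      also have "\<dots> = real_of_int ((2 * int m + 1) * n) * mesh m"
        unfolding mesh [symmetric] by simp
      finally have "of_int k * mesh m = of_int (2 * n) * pi
          \<longleftrightarrow> real_of_int k * mesh m = real_of_int ((2 * int m + 1) * n) * mesh m"
        by (simp only:)
      then show ?thesis
        using \<open>mesh m \<noteq> 0\<close> by (simp only: mult_cancel_right) simp
    qed
    then show ?thesis
      by simp
  qed
  also have "\<dots> \<longleftrightarrow> (2 * int m + 1) dvd k"
    unfolding of_int_eq_iff dvd_def ..
  finally have q_iff: "q = 1 \<longleftrightarrow> (2 * int m + 1) dvd k" .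
  show ?thesis
  proof (cases "q = 1")
    case True
    then show ?thesis
      using q_iff by (simp add: pow)
  next
    case False
    have "(\<Sum>l = 0..2 * m. echar k (mesh m * real l)) = (\<Sum>l<Suc (2 * m). q ^ l)"
      by (simp only: pow atLeast0AtMost lessThan_Suc_atMost)
    also have "\<dots> = 0"
      unfolding geometric_sum [OF False] q1 by simp
    finally show ?thesis
      using False q_iff by simp
  qed
qed

text \<open>\<open>centred_mod m j\<close> and \<open>centred_div m j\<close> are the j' and s of
  the overview. Shifting by \<open>m\<close> before and after the reduction places the residue in
  the frequency window of \<open>Hpoly\<close>.\<close>

definition centred_mod :: "nat \<Rightarrow> int \<Rightarrow> int" where
  "centred_mod m j = (j + int m) mod (2 * int m + 1) - int m"

definition centred_div :: "nat \<Rightarrow> int \<Rightarrow> int" where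
  "centred_div m j = (j + int m) div (2 * int m + 1)"

lemma centred_mod_centred_div: "j = (2 * int m + 1) * centred_div m j + centred_mod m j"
  using mult_div_mod_eq [of "2 * int m + 1" "j + int m"] unfolding centred_mod_def centred_div_def by linarith

lemma centred_mod_bounds: "- int m \<le> centred_mod m j" "centred_mod m j \<le> int m"
  using pos_mod_sign [of "2 * int m + 1" "j + int m"] pos_mod_bound [of "2 * int m + 1" "j + int m"]
  unfolding centred_mod_def by linarith+

text \<open>The window consists of \<open>2 * m + 1\<close> consecutive integers, hence of one
  representative per residue class. This makes the sum over frequencies in \<open>fcoef_Qop\<close>
  collapse to one term.\<close>

lemma dvd_diff_iff_centred_mod:
  assumes "k \<in> {- int m..int m}"
  shows "(2 * int m + 1) dvd (k - j) \<longleftrightarrow> k = centred_mod m j"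
proof
  assume "(2 * int m + 1) dvd (k - j)"
  then have "(2 * int m + 1) dvd ((k + int m) - (j + int m))"
    by simp
  then have "(k + int m) mod (2 * int m + 1) = (j + int m) mod (2 * int m + 1)"
    by (simp only: mod_eq_dvd_iff)
  moreover have "(k + int m) mod (2 * int m + 1) = k + int m"
    using assms by (intro mod_pos_pos_trivial) auto
  ultimately show "k = centred_mod m j"
    by (simp add: centred_mod_def)
next
  assume k: "k = centred_mod m j"
  have "k - j = (2 * int m + 1) * (- centred_div m j)"
    using centred_mod_centred_div [of j m] k by simp
  then show "(2 * int m + 1) dvd (k - j)"
    by (metis dvd_triv_left)
qed

lemma centred_mod_eq_self: "\<bar>j\<bar> \<le> int m \<Longrightarrow> centred_mod m j = j"
  using dvd_diff_iff_centred_mod [of j m j] by (simp add: abs_le_iff)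

text \<open>With s the quotient, \<open>\<bar>j\<bar>\<close> is at least
  \<open>(2 * m + 1) * \<bar>s\<bar> - m\<close>, and \<open>m\<close> is at most
  \<open>m * \<bar>s\<bar>\<close> because s is nonzero. Strictness is essential, as the
  monotonicity hypotheses compare only indices of different modulus.\<close>

lemma centred_div_less:
  assumes "\<bar>j\<bar> > int m"
  shows "centred_div m j \<noteq> 0" and "int m * \<bar>centred_div m j\<bar> < \<bar>j\<bar>"
proof -
  show nz: "centred_div m j \<noteq> 0"
    using centred_mod_centred_div [of j m] centred_mod_bounds [of m j] assms by auto
  then have "int m * 1 \<le> int m * \<bar>centred_div m j\<bar>"
    by (intro mult_left_mono) auto
  moreover have "\<bar>(2 * int m + 1) * centred_div m j\<bar> = 2 * (int m * \<bar>centred_div m j\<bar>) + \<bar>centred_div m j\<bar>"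
    unfolding abs_mult by (simp add: distrib_right)
  ultimately show "int m * \<bar>centred_div m j\<bar> < \<bar>j\<bar>"
    using centred_mod_centred_div [of j m] centred_mod_bounds [of m j] nz by linarith
qed

lemma L2T_Qop: "\<psi> \<in> L2T \<Longrightarrow> Qop lam bet \<phi> \<psi> m f \<in> L2T"
  unfolding Qop_def [abs_def] by (intro L2T_cmult L2T_sum L2T_shift)

text \<open>Each translate contributes a factor \<open>echar (- j)\<close> at its node and each
  sample a sum of \<open>echar k\<close>; summing over the nodes keeps only the k congruent to
  \<open>j\<close>, with a factor \<open>2 * m + 1\<close> that the average cancels.\<close>

lemma fcoef_Qop:
  assumes "is_phi lam \<phi>" "is_phi bet \<psi>" and g: "density_of \<phi> f \<in> L2T"
  shows "fcoef (\<lambda>x. complex_of_real (Qop lam bet \<phi> \<psi> m f x)) j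
    = bet (centred_mod m j) / lam (centred_mod m j) / bet j * fcoef (\<lambda>x. complex_of_real (density_of \<phi> f x)) (centred_mod m j)"
proof -
  define V where "V = Vop lam bet m (density_of \<phi> f)"
  define b where "b k = bet k / lam k * fcoef (\<lambda>x. complex_of_real (density_of \<phi> f x)) k" for k
  define M :: complex where "M = 2 * of_nat m + 1"
  have M0: "M \<noteq> 0"
    unfolding M_def by (metis of_nat_1 of_nat_Suc of_nat_mult of_nat_numeral of_nat_neq_0 add.commute plus_1_eq_Suc)
  have V: "complex_of_real (V x) = (\<Sum>k = - int m..int m. b k * echar k x)" for x
    unfolding V_def b_def by (rule Vop_of_real [OF assms])
  have \<psi>: "\<psi> \<in> L2T"
    using assms(2) by (simp add: is_phi_def)
  have s: "sq_integrable (\<lambda>x. complex_of_real (\<psi> (x - t)))" for t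
    using L2T_shift [OF \<psi>] by (simp add: L2T_iff)
  have c: "fcoef (\<lambda>x. complex_of_real (\<psi> (x - t))) j = echar (- j) t * inverse (bet j)" for t
    unfolding fcoef_shift [OF \<psi>] fcoef_is_phi [OF assms(2)] ..
  have "(\<lambda>x. complex_of_real (Qop lam bet \<phi> \<psi> m f x))
      = (\<lambda>x. 1 / M * (\<Sum>l = 0..2 * m. complex_of_real (V (mesh m * real l)) * complex_of_real (\<psi> (x - mesh m * real l))))"
    by (simp add: Qop_def V_def M_def)
  then have "fcoef (\<lambda>x. complex_of_real (Qop lam bet \<phi> \<psi> m f x)) j
      = 1 / M * (\<Sum>l = 0..2 * m. complex_of_real (V (mesh m * real l)) * (echar (- j) (mesh m * real l) * inverse (bet j)))"
    by (simp only: fcoef_cmult fcoef_sum [OF sq_integrable_cmult [OF s]] c)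
  also have "\<dots> = 1 / M * inverse (bet j) *
      (\<Sum>l = 0..2 * m. \<Sum>k = - int m..int m. b k * echar (k - j) (mesh m * real l))"
    by (simp add: V sum_distrib_left sum_distrib_right echar_mult mult_ac flip: diff_conv_add_uminus)
  also have "(\<Sum>l = 0..2 * m. \<Sum>k = - int m..int m. b k * echar (k - j) (mesh m * real l))
      = (\<Sum>k = - int m..int m. b k * (\<Sum>l = 0..2 * m. echar (k - j) (mesh m * real l)))"
    by (subst sum.swap) (simp add: sum_distrib_left)
  also have "\<dots> = (\<Sum>k = - int m..int m. if k = centred_mod m j then b k * M else 0)"
    by (intro sum.cong refl) (simp add: sum_echar_mesh dvd_diff_iff_centred_mod M_def)
  also have "\<dots> = b (centred_mod m j) * M"
    using centred_mod_bounds [of m j] by simp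
  finally show ?thesis
    using M0 by (simp add: b_def field_simps)
qed

text \<open>The only property of the chosen density on which the estimates rest, so they hold for
  whichever representative the choice operator returns.\<close>

lemma density_of_is_density: "f \<in> Phi_space \<phi> \<Longrightarrow> is_density \<phi> f (density_of \<phi> f)"
  unfolding Phi_space_def density_of_def by (drule CollectD, elim conjE, erule someI_ex)

lemma fcoef_Phi_space:
  assumes "is_phi lam \<phi>" "f \<in> Phi_space \<phi>"
  shows "fcoef (\<lambda>x. complex_of_real (f x)) k = fcoef (\<lambda>x. complex_of_real (density_of \<phi> f x)) k / lam k"
proof -
  have d: "density_of \<phi> f \<in> L2T" "AE x in lborel. f x = conv \<phi> (density_of \<phi> f) x"
    using density_of_is_density [OF assms(2)] by (auto simp: is_density_def)
  have f: "f \<in> borel_measurable borel"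
    using assms(2) by (simp add: Phi_space_def L2T_iff)
  have \<phi>: "\<phi> \<in> L2T"
    using assms(1) by (simp add: is_phi_def)
  have [measurable]: "\<phi> \<in> borel_measurable borel" "density_of \<phi> f \<in> borel_measurable borel"
    using \<phi> d(1) by (auto simp: L2T_iff)
  have "(\<lambda>x. conv \<phi> (density_of \<phi> f) x) \<in> borel_measurable borel"
    unfolding conv_def circ_set_integral by measurable
  then have "fcoef (\<lambda>x. complex_of_real (f x)) k = fcoef (\<lambda>x. complex_of_real (conv \<phi> (density_of \<phi> f) x)) k"
    using AE_circ [OF d(2)] f unfolding fcoef_def
    by (intro arg_cong2 [where f = "(/)"] refl integral_cong_AE measurable_circ) auto
  then show ?thesis
    by (simp add: fcoef_conv [OF \<phi> d(1)] fcoef_is_phi [OF assms(1)] divide_inverse mult.commute)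
qed

lemma Bessel_L2norm:
  assumes "g \<in> L2T" "finite F"
  shows "(\<Sum>k\<in>F. (cmod (fcoef (\<lambda>x. complex_of_real (g x)) k))\<^sup>2) \<le> (L2norm g)\<^sup>2"
  using Bessel_inequality [OF sq_integrable_L2T [OF assms(1)] assms(2)]
  unfolding L2norm_squared by (simp add: field_simps)

text \<open>Since \<open>j\<close> is recovered from its residue and quotient, the sum runs over a
  set of pairs; by nonnegativity it may be enlarged to a full rectangle, where it factors. The
  condition on \<open>F\<close> keeps the quotient 0 out.\<close>

lemma sum_centred_mod_centred_div_le:
  fixes u a :: "int \<Rightarrow> real"
  assumes F: "finite F" "F \<subseteq> {j. \<bar>j\<bar> > int m}"
    and u: "\<And>k. u k \<ge> 0" and a: "\<And>s. a s \<ge> 0" "a summable_on (UNIV - {0})"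
    and U: "(\<Sum>k = - int m..int m. u k) \<le> U"
  shows "(\<Sum>j\<in>F. u (centred_mod m j) * a (centred_div m j)) \<le> U * (\<Sum>\<^sub>\<infinity>s\<in>UNIV - {0}. a s)"
proof -
  let ?p = "\<lambda>j. (centred_mod m j, centred_div m j)"
  have "inj_on ?p F"
    by (rule inj_onI) (metis centred_mod_centred_div prod.inject)
  then have "(\<Sum>j\<in>F. u (centred_mod m j) * a (centred_div m j)) = (\<Sum>(r, s)\<in>?p ` F. u r * a s)"
    by (simp add: sum.reindex)
  also have "\<dots> \<le> (\<Sum>(r, s)\<in>{- int m..int m} \<times> centred_div m ` F. u r * a s)"
    using centred_mod_bounds F(1) by (intro sum_mono2) (auto simp: u a)
  also have "\<dots> = (\<Sum>k = - int m..int m. u k) * (\<Sum>s\<in>centred_div m ` F. a s)"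
    by (simp add: sum_product sum.cartesian_product)
  also have "\<dots> \<le> U * (\<Sum>\<^sub>\<infinity>s\<in>UNIV - {0}. a s)"
  proof (rule mult_mono [OF U])
    show "(\<Sum>s\<in>centred_div m ` F. a s) \<le> (\<Sum>\<^sub>\<infinity>s\<in>UNIV - {0}. a s)"
      using F centred_div_less(1) by (intro finite_sum_le_infsum) (auto simp: a)
    have "0 \<le> (\<Sum>k = - int m..int m. u k)"
      by (intro sum_nonneg u)
    with U show "0 \<le> U"
      by linarith
  qed (auto intro: sum_nonneg a)
  finally show ?thesis .
qed

section \<open>The error estimate\<close>

text \<open>The factors 2 come from \<open>cmod_add_squared_le\<close>. The part with
  \<open>c2\<close> alone accounts for the missing high frequencies of \<open>f\<close>, the part
  with \<open>c1 * c2\<close> for aliasing.\<close>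

lemma Qop_error:
  fixes lam bet :: "int \<Rightarrow> complex"
  assumes nz: "\<forall>k. lam k \<noteq> 0" "\<forall>k. bet k \<noteq> 0"
    and phi: "is_phi lam \<phi>" "is_phi bet \<psi>"
    and c1: "c1 > 0" "\<And>k l. \<bar>k\<bar> > \<bar>l\<bar> \<Longrightarrow> cmod (bet k) / cmod (lam k) \<ge> c1 * (cmod (bet l) / cmod (lam l))"
    and c2: "c2 > 0" "\<And>k l. \<bar>k\<bar> > \<bar>l\<bar> \<Longrightarrow> cmod (lam k) \<ge> c2 * cmod (lam l)"
    and m: "m \<ge> 1" and f: "f \<in> Phi_space \<phi>"
  shows "(L2norm (\<lambda>x. f x - Qop lam bet \<phi> \<psi> m f x))\<^sup>2
    \<le> (2 / c2\<^sup>2 + 2 / (c1 * c2)\<^sup>2) * ((Phi_norm \<phi> f)\<^sup>2 * (\<Sum>\<^sub>\<infinity>k\<in>UNIV - {0}. 1 / (cmod (lam (int m * k)))\<^sup>2))"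
proof -
  define g where "g = density_of \<phi> f"
  define G where "G k = fcoef (\<lambda>x. complex_of_real (g x)) k" for k
  define h where "h x = f x - Qop lam bet \<phi> \<psi> m f x" for x
  define a where "a k = 1 / (cmod (lam (int m * k)))\<^sup>2" for k
  define A where "A = (\<Sum>\<^sub>\<infinity>k\<in>UNIV - {0}. a k)"
  let ?N = "(Phi_norm \<phi> f)\<^sup>2"
  have g: "g \<in> L2T"
    using density_of_is_density [OF f] by (auto simp: is_density_def g_def)
  have fL: "f \<in> L2T"
    using f by (simp add: Phi_space_def)
  have QL: "Qop lam bet \<phi> \<psi> m f \<in> L2T"
    using phi(2) by (intro L2T_Qop) (simp add: is_phi_def)
  have hL: "h \<in> L2T"
    unfolding h_def [abs_def] by (intro L2T_diff fL QL)
  have bessel: "(\<Sum>k\<in>F. (cmod (G k))\<^sup>2) \<le> ?N" if "finite F" for F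
    unfolding G_def Phi_norm_def g_def [symmetric] by (rule Bessel_L2norm [OF g that])
  \<comment> \<open>\<open>infsum\<close> is 0 by convention on families that are not summable, so
    summability is what makes the right-hand side a genuine bound.\<close>
  have summ: "a summable_on (UNIV - {0})"
    unfolding a_def by (rule is_phi_summable_multiples [OF phi(1) m])
  have coef: "fcoef (\<lambda>x. complex_of_real (h x)) j
      = G j / lam j - bet (centred_mod m j) / lam (centred_mod m j) / bet j * G (centred_mod m j)" for j
    using fcoef_diff [OF sq_integrable_L2T [OF fL] sq_integrable_L2T [OF QL]] g
    by (simp add: h_def fcoef_Phi_space [OF phi(1) f] fcoef_Qop [OF phi] G_def g_def)
  have a0: "a k \<ge> 0" for k
    by (simp add: a_def)
  have a1: "a 1 \<le> A"
    using finite_sum_le_infsum [OF summ, of "{1}"] a0 by (simp add: A_def)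
  \<comment> \<open>Applied with two values of \<open>s\<close>: the quotient of \<open>j\<close>
    for the aliased part, and 1 for the coefficient of \<open>f\<close> itself.\<close>
  have lam_le: "1 / (cmod (lam j))\<^sup>2 \<le> a s / c2\<^sup>2" if "int m * \<bar>s\<bar> < \<bar>j\<bar>" for j s
  proof -
    have "c2 * cmod (lam (int m * s)) \<le> cmod (lam j)"
      using that by (intro c2) (simp add: abs_mult)
    then have "(c2 * cmod (lam (int m * s)))\<^sup>2 \<le> (cmod (lam j))\<^sup>2"
      using c2(1) by (intro power_mono) auto
    then have "1 / (cmod (lam j))\<^sup>2 \<le> 1 / (c2 * cmod (lam (int m * s)))\<^sup>2"
      using c2(1) nz by (intro divide_left_mono) auto
    then show ?thesis
      by (simp add: a_def power_mult_distrib mult.commute)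
  qed
  \<comment> \<open>Inside the window \<open>j\<close> is its own residue, so the \<open>bet\<close>
    factors cancel and both parts of the coefficient equal \<open>G j / lam j\<close>.\<close>
  have zero: "fcoef (\<lambda>x. complex_of_real (h x)) j = 0" if "\<bar>j\<bar> \<le> int m" for j
    using nz by (simp add: coef centred_mod_eq_self [OF that])
  have tail: "(cmod (fcoef (\<lambda>x. complex_of_real (h x)) j))\<^sup>2
      \<le> 2 / c2\<^sup>2 * A * (cmod (G j))\<^sup>2 + 2 / (c1 * c2)\<^sup>2 * ((cmod (G (centred_mod m j)))\<^sup>2 * a (centred_div m j))"
    if j: "int m < \<bar>j\<bar>" for j
  proof -
    let ?r = "centred_mod m j"
    let ?b = "cmod (bet ?r) / cmod (lam ?r) / cmod (bet j)"
    \<comment> \<open>The residue has modulus at most \<open>m\<close>, hence strictly below that of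
      \<open>j\<close>. Dividing by \<open>cmod (bet j)\<close> then leaves a bound in terms of
      \<open>lam j\<close> alone.\<close>
    have "c1 * (cmod (bet ?r) / cmod (lam ?r)) \<le> cmod (bet j) / cmod (lam j)"
      using centred_mod_bounds [of m j] j by (intro c1) linarith
    then have "?b \<le> 1 / c1 * (1 / cmod (lam j))"
      using c1(1) nz by (simp add: field_simps)
    then have "?b\<^sup>2 \<le> (1 / c1 * (1 / cmod (lam j)))\<^sup>2"
      by (intro power_mono) auto
    also have "\<dots> = 1 / c1\<^sup>2 * (1 / (cmod (lam j))\<^sup>2)"
      by (simp only: power_mult_distrib power_one_over)
    also have "\<dots> \<le> 1 / c1\<^sup>2 * (a (centred_div m j) / c2\<^sup>2)"
      by (intro mult_left_mono lam_le centred_div_less j) auto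
    finally have b: "?b\<^sup>2 \<le> a (centred_div m j) / (c1 * c2)\<^sup>2"
      by (simp add: power_mult_distrib)
    have "1 / (cmod (lam j))\<^sup>2 \<le> a 1 / c2\<^sup>2"
      using j by (intro lam_le) simp
    also have "\<dots> \<le> A / c2\<^sup>2"
      using a1 by (intro divide_right_mono) auto
    finally have l: "1 / (cmod (lam j))\<^sup>2 \<le> A / c2\<^sup>2" .
    have "(cmod (fcoef (\<lambda>x. complex_of_real (h x)) j))\<^sup>2
        \<le> 2 * (cmod (G j / lam j))\<^sup>2 + 2 * (cmod (- (bet ?r / lam ?r / bet j * G ?r)))\<^sup>2"
      unfolding coef diff_conv_add_uminus by (rule cmod_add_squared_le)
    also have "\<dots> = 2 * (cmod (G j))\<^sup>2 * (1 / (cmod (lam j))\<^sup>2) + 2 * (cmod (G ?r))\<^sup>2 * ?b\<^sup>2"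
      by (simp add: norm_mult norm_divide power_mult_distrib power_divide)
    also have "\<dots> \<le> 2 * (cmod (G j))\<^sup>2 * (A / c2\<^sup>2) + 2 * (cmod (G ?r))\<^sup>2 * (a (centred_div m j) / (c1 * c2)\<^sup>2)"
      by (intro add_mono mult_left_mono l b) auto
    finally show ?thesis
      by (simp add: algebra_simps)
  qed
  have "(L2norm h)\<^sup>2 \<le> (2 / c2\<^sup>2 + 2 / (c1 * c2)\<^sup>2) * (?N * A)"
  proof (rule L2norm_le_fcoef)
    show "h \<in> borel_measurable borel" "integrable circ (\<lambda>x. (h x)\<^sup>2)"
      using hL by (auto simp: L2T_def circ_set_integrable)
    fix F :: "int set" assume F: "finite F"
    define F' where "F' = {j \<in> F. int m < \<bar>j\<bar>}"
    have F': "finite F'" "F' \<subseteq> {j. int m < \<bar>j\<bar>}"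
      using F by (auto simp: F'_def)
    have A0: "A \<ge> 0"
      unfolding A_def a_def by (intro infsum_nonneg) auto
    have "(\<Sum>j\<in>F. (cmod (fcoef (\<lambda>x. complex_of_real (h x)) j))\<^sup>2)
        = (\<Sum>j\<in>F'. (cmod (fcoef (\<lambda>x. complex_of_real (h x)) j))\<^sup>2)"
    proof (intro sum.mono_neutral_right F ballI)
      fix j assume "j \<in> F - F'"
      then have "\<bar>j\<bar> \<le> int m"
        by (auto simp: F'_def)
      then show "(cmod (fcoef (\<lambda>x. complex_of_real (h x)) j))\<^sup>2 = 0"
        by (simp add: zero)
    qed (auto simp: F'_def)
    also have "\<dots> \<le> (\<Sum>j\<in>F'. 2 / c2\<^sup>2 * A * (cmod (G j))\<^sup>2
        + 2 / (c1 * c2)\<^sup>2 * ((cmod (G (centred_mod m j)))\<^sup>2 * a (centred_div m j)))"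
      by (intro sum_mono tail) (simp add: F'_def)
    also have "\<dots> = 2 / c2\<^sup>2 * A * (\<Sum>j\<in>F'. (cmod (G j))\<^sup>2)
        + 2 / (c1 * c2)\<^sup>2 * (\<Sum>j\<in>F'. (cmod (G (centred_mod m j)))\<^sup>2 * a (centred_div m j))"
      by (simp only: sum.distrib sum_distrib_left)
    \<comment> \<open>Bessel's inequality for the density is used over two sets: the high
      frequencies in \<open>F'\<close>, and the window of residues.\<close>
    also have "\<dots> \<le> 2 / c2\<^sup>2 * A * ?N + 2 / (c1 * c2)\<^sup>2 * (?N * A)"
    proof (intro add_mono mult_left_mono bessel F'(1))
      show "(\<Sum>j\<in>F'. (cmod (G (centred_mod m j)))\<^sup>2 * a (centred_div m j)) \<le> ?N * A"
        unfolding A_def by (rule sum_centred_mod_centred_div_le [OF F' _ _ summ bessel]) (auto simp: a_def)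
    qed (use A0 in auto)
    finally show "(\<Sum>j\<in>F. (cmod (fcoef (\<lambda>x. complex_of_real (h x)) j))\<^sup>2)
        \<le> (2 / c2\<^sup>2 + 2 / (c1 * c2)\<^sup>2) * (?N * A)"
      by (simp add: algebra_simps)
  qed
  then show ?thesis
    unfolding h_def [abs_def] A_def a_def .
qed

lemma Mn_le_Qop:
  assumes "\<And>f. f \<in> W \<Longrightarrow> L2norm (\<lambda>x. f x - Qop lam bet \<phi> \<psi> m f x) \<le> C"
  shows "Mn (2 * m + 1) W \<psi> \<le> ennreal C"
  unfolding Mn_def
proof (rule SUP_least)
  fix f assume f: "f \<in> W"
  \<comment> \<open>Translates in \<open>Mn\<close> are numbered from 1 and grid points from 0,
    hence the index \<open>l - 1\<close>.\<close>
  define c where "c l = Vop lam bet m (density_of \<phi> f) (mesh m * real (l - 1)) / (2 * real m + 1)" for l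
  define y where "y l = mesh m * real (l - 1)" for l
  have y: "y l \<in> {0..2 * pi}" if "l \<in> {1..2 * m + 1}" for l
  proof -
    have "real (l - 1) \<le> 2 * real m + 1"
      using that by auto
    then have "real (l - 1) / (2 * real m + 1) \<le> 1"
      by simp
    then have "2 * pi * (real (l - 1) / (2 * real m + 1)) \<le> 2 * pi * 1"
      by (intro mult_left_mono) auto
    then show ?thesis
      by (simp add: y_def mesh_def)
  qed
  have "Qop lam bet \<phi> \<psi> m f x = (\<Sum>l = 1..2 * m + 1. c l * \<psi> (x - y l))" for x
  proof -
    have "(\<Sum>l = 1..2 * m + 1. c l * \<psi> (x - y l)) = (\<Sum>l = 0..2 * m. c (Suc l) * \<psi> (x - y (Suc l)))"
      using sum.shift_bounds_cl_Suc_ivl [of "\<lambda>l. c l * \<psi> (x - y l)" 0 "2 * m"] by simp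
    then show ?thesis
      by (simp add: Qop_def c_def y_def sum_distrib_left)
  qed
  then have "ennreal (L2norm (\<lambda>x. f x - (\<Sum>l = 1..2 * m + 1. c l * \<psi> (x - y l)))) \<le> ennreal C"
    using assms [OF f] by (simp add: ennreal_leI)
  then show "(INF (c, y)\<in>{(c, y). \<forall>l\<in>{1..2 * m + 1}. y l \<in> {0..2 * pi}}.
      ennreal (L2norm (\<lambda>x. f x - (\<Sum>l = 1..2 * m + 1. c l * \<psi> (x - y l))))) \<le> ennreal C"
    using y by (intro INF_lower2 [of "(c, y)"]) auto
qed

theorem theorem2p3:
  fixes lam bet :: "int \<Rightarrow> complex" and \<phi> \<psi> :: "real \<Rightarrow> real"
  assumes "\<forall>k. lam k \<noteq> 0" and "\<forall>k. bet k \<noteq> 0"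
    and "is_phi lam \<phi>" and "is_phi bet \<psi>"
    and "nondecreasing_type (\<lambda>k. cmod (bet k) / cmod (lam k))"
    and "nondecreasing_type (\<lambda>k. cmod (lam k))"
  shows "\<exists>c>0.
    (\<forall>m\<ge>1. \<forall>f\<in>Phi_space \<phi>.
       L2norm (\<lambda>x. f x - Qop lam bet \<phi> \<psi> m f x)
         \<le> c * Phi_norm \<phi> f * sqrt (\<Sum>\<^sub>\<infinity>k\<in>UNIV - {0}. 1 / (cmod (lam (int m * k)))\<^sup>2)) \<and>
    (\<forall>m\<ge>1. Mn (2 * m + 1) (Phi_ball \<phi>) \<psi>
         \<le> ennreal (c * sqrt (\<Sum>\<^sub>\<infinity>k\<in>UNIV - {0}. 1 / (cmod (lam (int m * k)))\<^sup>2)))"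
proof -
  obtain c1 where c1: "c1 > 0"
    "\<And>k l. \<bar>k\<bar> > \<bar>l\<bar> \<Longrightarrow> cmod (bet k) / cmod (lam k) \<ge> c1 * (cmod (bet l) / cmod (lam l))"
    using assms(5) unfolding nondecreasing_type_def by blast
  obtain c2 where c2: "c2 > 0" "\<And>k l. \<bar>k\<bar> > \<bar>l\<bar> \<Longrightarrow> cmod (lam k) \<ge> c2 * cmod (lam l)"
    using assms(6) unfolding nondecreasing_type_def by blast
  \<comment> \<open>\<open>Qop_error\<close> bounds the square of the norm by \<open>K\<close>, so
    \<open>sqrt K\<close> is the constant for both claims.\<close>
  define K where "K = 2 / c2\<^sup>2 + 2 / (c1 * c2)\<^sup>2"
  have K: "K > 0"
    using c1(1) c2(1) by (simp add: K_def add_pos_pos)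
  let ?A = "\<lambda>m. \<Sum>\<^sub>\<infinity>k\<in>UNIV - {0}. 1 / (cmod (lam (int m * k)))\<^sup>2"
  have A0: "?A m \<ge> 0" for m :: nat
    by (intro infsum_nonneg) auto
  have norm0: "Phi_norm \<phi> f \<ge> 0" for f
    by (simp add: Phi_norm_def L2norm_def set_lebesgue_integral_def)
  have main: "L2norm (\<lambda>x. f x - Qop lam bet \<phi> \<psi> m f x) \<le> sqrt K * Phi_norm \<phi> f * sqrt (?A m)"
    if "m \<ge> 1" "f \<in> Phi_space \<phi>" for m :: nat and f
  proof (rule power2_le_imp_le)
    show "(L2norm (\<lambda>x. f x - Qop lam bet \<phi> \<psi> m f x))\<^sup>2 \<le> (sqrt K * Phi_norm \<phi> f * sqrt (?A m))\<^sup>2"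
      using Qop_error [OF assms(1-4) c1 c2 that, folded K_def] K A0 [of m]
      by (simp add: power_mult_distrib mult.assoc)
  qed (intro mult_nonneg_nonneg norm0, use K A0 [of m] in auto)
  have ball: "L2norm (\<lambda>x. f x - Qop lam bet \<phi> \<psi> m f x) \<le> sqrt K * sqrt (?A m)"
    if "m \<ge> 1" "f \<in> Phi_ball \<phi>" for m :: nat and f
  proof -
    have f: "f \<in> Phi_space \<phi>" "Phi_norm \<phi> f \<le> 1"
      using that(2) by (auto simp: Phi_ball_def)
    have "sqrt K * Phi_norm \<phi> f * sqrt (?A m) \<le> sqrt K * 1 * sqrt (?A m)"
      using K A0 [of m] f(2) by (intro mult_right_mono mult_left_mono) auto
    with main [OF that(1) f(1)] show ?thesis
      by simp
  qed
  show ?thesis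
    using K main ball by (intro exI [of _ "sqrt K"] conjI allI impI ballI Mn_le_Qop) auto
qed

end
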